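(* Let $X=(x_0,x_1)$ be a bounded interval and set $$\mathscr{C}(X)=\Bigl\{\zeta\in C_{{\rm pw},+}(X)\ :\ \zeta(x_0+)=1\ \text{ and }\ \alpha_{\rm reg}\in L^2(X),\ \text{where }\alpha=-\bigl(\tfrac12\log\zeta\bigr)'\Bigr\}.$$ The mapping $$\mathscr{C}(X)\to L^\infty(\mathbb{R})\cap C^\infty(\mathbb{R}),\qquad \zeta\mapsto g_\zeta(0)$$ is injective.
   Context: A function on $X$ is regulated if it is a uniform limit of step functions (piecewise-constant with finitely many discontinuities); $\mathrm{Reg}_+(X)$ is the set of regulated $f$ with $f>\varepsilon$ on $X$ for some $\varepsilon>0$. $C_{{\rm pw},+}(X)$ is the set of $f\in\mathrm{Reg}_+(X)$ for which there is a finite partition of $X$ such that $f$ is absolutely continuous on each open subinterval of the partition. Functions equal almost everywhere are identified. One-sided limits are written $f(x\pm)$. For $\zeta\in C_{{\rm pw},+}(X)$ the distribution $\alpha=-(\frac12\log\zeta)'$ decomposes as $\alpha=\alpha_{\rm reg}+\alpha_{\rm sing}$ with $\alpha_{\rm reg}\in L^1(X)$ real-valued (the a.e. derivative) and $\alpha_{\rm sing}$ a finite linear combination of Dirac deltas at the jump points of $\zeta$. Generalized reflection coefficient: $\mathbb{D}$ is the open unit disk; for $\omega\in\mathbb{R}\setminus\{0\}$ put $u^{\ell}=\frac12\bigl(u-\frac{1}{i\omega}u'\bigr)$, $u^{\rm r}=\frac12\bigl(u+\frac{1}{i\omega}u'\bigr)$. For $\zeta\in\mathrm{Reg}_+(X)$,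 for all $\omega\in\mathbb{R}$ outside a countable set (containing $0$) and every $\xi\in\mathbb{D}$, the problem $(\zeta u')'+\omega^2\zeta u=0$ on $X$, $u^{\rm r}(x_0+)=1$, $u^{\ell}(x_1-)=\xi u^{\rm r}(x_1-)$ has a unique solution $u$ with $u$ and $\zeta u'$ absolutely continuous (equation holding a.e.); $g_\zeta^\omega(\xi)=u^{\ell}(x_0+)$. $g_\zeta(0)$ denotes the function $\omega\mapsto g_\zeta^\omega(0)$ (the reflection coefficient), which for $\zeta\in C_{{\rm pw},+}(X)$ agrees almost everywhere with a unique bounded $C^\infty$ function on $\mathbb{R}$, with which it is identified. *)

theory Defs
  imports "HOL-Analysis.Analysis"
begin

text \<open>
  Throughout, \<open>X = (x0, x1)\<close>. A function on \<open>X\<close> is represented by a total function on the reals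
  of which only the values on \<open>X\<close> matter, and elements of the function spaces below are
  representatives of classes modulo equality almost everywhere on \<open>X\<close>.
\<close>

definition ae_equal_on :: "real set \<Rightarrow> (real \<Rightarrow> 'a) \<Rightarrow> (real \<Rightarrow> 'a) \<Rightarrow> bool" where
  "ae_equal_on S f g \<longleftrightarrow> (AE x in lebesgue. x \<in> S \<longrightarrow> f x = g x)"

definition interval_partition :: "real \<Rightarrow> real \<Rightarrow> nat \<Rightarrow> (nat \<Rightarrow> real) \<Rightarrow> bool" where
  "interval_partition x0 x1 n p \<longleftrightarrow> p 0 = x0 \<and> p n = x1 \<and> (\<forall>i<n. p i < p (Suc i))"

text \<open>The values at the partition points are unconstrained.\<close>

definition step_function_on :: "real \<Rightarrow> real \<Rightarrow> (real \<Rightarrow> real) \<Rightarrow> bool" where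
  "step_function_on x0 x1 f \<longleftrightarrow>
     (\<exists>n p. interval_partition x0 x1 n p \<and> (\<forall>i<n. f constant_on {p i<..<p (Suc i)}))"

definition regulated_on :: "real \<Rightarrow> real \<Rightarrow> (real \<Rightarrow> real) \<Rightarrow> bool" where
  "regulated_on x0 x1 f \<longleftrightarrow>
     (\<exists>s. (\<forall>k. step_function_on x0 x1 (s k)) \<and> uniform_limit {x0<..<x1} s f sequentially)"

definition Reg_pos :: "real \<Rightarrow> real \<Rightarrow> (real \<Rightarrow> real) set" where
  "Reg_pos x0 x1 = {f. regulated_on x0 x1 f \<and> (\<exists>\<epsilon>>0. \<forall>x\<in>{x0<..<x1}. f x > \<epsilon>)}"

text \<open>Absolute continuity of a function on an interval \<open>S\<close>, in the usual sense of Vitali; on a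
  bounded open interval this is the global (not the local) notion.\<close>

definition abs_continuous_on :: "real set \<Rightarrow> (real \<Rightarrow> 'a::metric_space) \<Rightarrow> bool" where
  "abs_continuous_on S f \<longleftrightarrow>
     (\<forall>\<epsilon>>0. \<exists>\<delta>>0. \<forall>(n::nat) a b.
        (\<forall>i<n. a i \<le> b i \<and> {a i..b i} \<subseteq> S) \<and>
        disjoint_family_on (\<lambda>i. {a i<..<b i}) {..<n} \<and>
        (\<Sum>i<n. b i - a i) < \<delta> \<longrightarrow>
        (\<Sum>i<n. dist (f (a i)) (f (b i))) < \<epsilon>)"

definition Cpw_pos :: "real \<Rightarrow> real \<Rightarrow> (real \<Rightarrow> real) set" where
  "Cpw_pos x0 x1 =
     {f \<in> Reg_pos x0 x1.
        \<exists>n p. interval_partition x0 x1 n p \<and> (\<forall>i<n. abs_continuous_on {p i<..<p (Suc i)} f)}"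

text \<open>The regular part of the distribution \<open>\<alpha> = - (1/2 log \<zeta>)'\<close>, i.e. its almost everywhere
  defined pointwise derivative; the singular part consists of the Dirac deltas at the jumps.\<close>

definition alpha_reg :: "(real \<Rightarrow> real) \<Rightarrow> real \<Rightarrow> real" where
  "alpha_reg \<zeta> x = - deriv (\<lambda>t. 1/2 * ln (\<zeta> t)) x"

definition L2_on :: "real set \<Rightarrow> (real \<Rightarrow> real) set" where
  "L2_on S = {f. f \<in> borel_measurable (lebesgue_on S) \<and> integrable (lebesgue_on S) (\<lambda>x. (f x)\<^sup>2)}"

definition impedance_class :: "real \<Rightarrow> real \<Rightarrow> (real \<Rightarrow> real) set" where
  "impedance_class x0 x1 =
     {\<zeta> \<in> Cpw_pos x0 x1. (\<zeta> \<longlongrightarrow> 1) (at_right x0) \<and> alpha_reg \<zeta> \<in> L2_on {x0<..<x1}}"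

text \<open>
  Since \<open>u'\<close> need not exist at the jumps of \<open>\<zeta>\<close>, it is carried along as a second function \<open>du\<close>:
  the representative of the almost everywhere derivative of \<open>u\<close> for which \<open>\<zeta> u'\<close> is absolutely
  continuous. This determines \<open>du\<close> on \<open>X\<close>, and its one-sided limits exist because those of
  \<open>\<zeta>\<close> do.
\<close>

definition left_part :: "real \<Rightarrow> (real \<Rightarrow> complex) \<Rightarrow> (real \<Rightarrow> complex) \<Rightarrow> real \<Rightarrow> complex" where
  "left_part \<omega> u du x = 1/2 * (u x - 1 / (\<i> * of_real \<omega>) * du x)"

definition right_part :: "real \<Rightarrow> (real \<Rightarrow> complex) \<Rightarrow> (real \<Rightarrow> complex) \<Rightarrow> real \<Rightarrow> complex" where
  "right_part \<omega> u du x = 1/2 * (u x + 1 / (\<i> * of_real \<omega>) * du x)"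

definition helmholtz_solution ::
  "real \<Rightarrow> real \<Rightarrow> (real \<Rightarrow> real) \<Rightarrow> real \<Rightarrow> (real \<Rightarrow> complex) \<Rightarrow> (real \<Rightarrow> complex) \<Rightarrow> bool" where
  "helmholtz_solution x0 x1 \<zeta> \<omega> u du \<longleftrightarrow>
     abs_continuous_on {x0<..<x1} u \<and>
     (AE x in lebesgue. x \<in> {x0<..<x1} \<longrightarrow> (u has_vector_derivative du x) (at x)) \<and>
     abs_continuous_on {x0<..<x1} (\<lambda>x. of_real (\<zeta> x) * du x) \<and>
     (AE x in lebesgue. x \<in> {x0<..<x1} \<longrightarrow>
        (\<exists>d. ((\<lambda>x. of_real (\<zeta> x) * du x) has_vector_derivative d) (at x) \<and>
             d + (of_real \<omega>)\<^sup>2 * of_real (\<zeta> x) * u x = 0))"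

definition bvp_solution ::
  "real \<Rightarrow> real \<Rightarrow> (real \<Rightarrow> real) \<Rightarrow> real \<Rightarrow> complex \<Rightarrow> (real \<Rightarrow> complex) \<Rightarrow> (real \<Rightarrow> complex) \<Rightarrow> bool" where
  "bvp_solution x0 x1 \<zeta> \<omega> \<xi> u du \<longleftrightarrow>
     helmholtz_solution x0 x1 \<zeta> \<omega> u du \<and>
     (right_part \<omega> u du \<longlongrightarrow> 1) (at_right x0) \<and>
     (\<exists>r. (right_part \<omega> u du \<longlongrightarrow> r) (at_left x1) \<and> (left_part \<omega> u du \<longlongrightarrow> \<xi> * r) (at_left x1))"

text \<open>Only meaningful for \<open>\<xi>\<close> in the open unit disk and those nonzero \<open>\<omega>\<close> for which the boundary
  value problem is uniquely solvable, which is almost every \<open>\<omega>\<close>.\<close>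

definition gen_refl_coeff :: "real \<Rightarrow> real \<Rightarrow> (real \<Rightarrow> real) \<Rightarrow> real \<Rightarrow> complex \<Rightarrow> complex" where
  "gen_refl_coeff x0 x1 \<zeta> \<omega> \<xi> =
     (THE c. \<exists>u du. bvp_solution x0 x1 \<zeta> \<omega> \<xi> u du \<and> (left_part \<omega> u du \<longlongrightarrow> c) (at_right x0))"

definition bounded_smooth :: "(real \<Rightarrow> complex) set" where
  "bounded_smooth =
     {G. bounded (range G) \<and>
         (\<forall>n. ((\<lambda>h x. vector_derivative h (at x)) ^^ n) G differentiable_on UNIV)}"

definition refl_coeff :: "real \<Rightarrow> real \<Rightarrow> (real \<Rightarrow> real) \<Rightarrow> real \<Rightarrow> complex" where
  "refl_coeff x0 x1 \<zeta> =
     (THE G. G \<in> bounded_smooth \<and> ae_equal_on UNIV G (\<lambda>\<omega>. gen_refl_coeff x0 x1 \<zeta> \<omega> 0))"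

end

theory Submission
  imports Defs "HOL-Complex_Analysis.Complex_Analysis"
begin

text \<open>
  With \<open>s = \<i> \<omega>\<close> and \<open>z = \<zeta> u' / s\<close> the equation becomes \<open>u' = s z / \<zeta>\<close>, \<open>z' = s \<zeta> u\<close>, whose
  fundamental matrix \<open>M(x, s)\<close> is entire in \<open>s\<close>. The reflection coefficient is a quotient of entries
  of \<open>M(x1, s)\<close> whose denominator has no zeros in \<open>Re s \<le> 0\<close>, by dissipation of the flux
  \<open>Re (u cnj z)\<close>. If two media have the same reflection coefficient on the imaginary axis, then also
  on \<open>Re s \<le> 0\<close>. There the solution that is purely left going at \<open>x0\<close> grows at most like
  \<open>exp (- Re s (x - x0))\<close>, the one selected by the right boundary condition decays like the inverse, and
  both have the same initial values in the two media; the constants are uniform in \<open>s\<close> since \<open>\<zeta>\<close>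
  has bounded variation. Hence the second row of \<open>M\<^sub>1(x, s) M\<^sub>2(x, s)\<^sup>-\<^sup>1\<close> is bounded on \<open>Re s \<le> 0\<close>, by
  parity on the whole plane, and by Liouville it equals its value \<open>(0, 1)\<close> at \<open>s = 0\<close>. The coefficient
  of \<open>s\<close> in the resulting identity gives equal integrals of the two impedances over \<open>(x0, x)\<close>, for every \<open>x\<close>.
\<close>

subsection \<open>Absolutely continuous functions\<close>

text \<open>Liouville's theorem applies only if the exponents of growth and decay cancel exactly. A
  Gronwall bound for the system has \<open>norm s\<close> in the exponent and would not do: only
  \<open>Re s\<close> may occur, so the obstacle is uniformity in \<open>Im s\<close>. It is met by
  the energy \<open>\<rho> |u|^2 + |z|^2 / \<rho>\<close>. In a homogeneous medium of impedance
  \<open>\<rho>\<close>, \<open>Im s\<close> drops out of its derivative; a variable medium is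
  treated as a limit of step media, at the price of a factor governed by the variation alone. The
  rates of two different media match because waves travel with unit speed whatever the impedance.
  The normalization \<open>\<zeta>(x0+) = 1\<close> gives both media the same frame at the left end:
  there the reflection coefficient \<open>g\<close> alone fixes the initial values
  \<open>(1 + g, 1 - g)\<close>. The limits of the two impedances at the right end may differ a
  priori; they enter only the constants. Jumps are harmless because \<open>z\<close>, unlike
  \<open>u'\<close>, is continuous across them. Since \<open>\<zeta>\<close> is arbitrary at the
  partition points, the analysis is done for a function \<open>r\<close> that equals
  \<open>\<zeta>\<close> off a finite set and has bounds on the whole line.\<close>

lemma abs_continuous_onD:
  assumes "abs_continuous_on S f" "\<epsilon> > 0"
  obtains \<delta> where "\<delta> > 0" "\<And>(n::nat) a b.
        (\<And>i. i < n \<Longrightarrow> a i \<le> b i \<and> {a i..b i} \<subseteq> S) \<Longrightarrow>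
        disjoint_family_on (\<lambda>i. {a i<..<b i}) {..<n} \<Longrightarrow>
        (\<Sum>i<n. b i - a i) < \<delta> \<Longrightarrow> (\<Sum>i<n. dist (f (a i)) (f (b i))) < \<epsilon>"
  using assms unfolding abs_continuous_on_def by meson

text \<open>A gauge proof: points where the derivative vanishes are tags of intervals with small
  increments, and the exceptional null set is covered by an open set of small measure.\<close>

lemma abs_continuous_derivative_zero_le:
  fixes f :: "real \<Rightarrow> 'a::real_normed_vector"
  assumes ac: "abs_continuous_on {a<..<b} f"
    and ae: "AE x in lebesgue. x \<in> {a<..<b} \<longrightarrow> (f has_vector_derivative 0) (at x)"
    and x: "a < x" "x \<le> y" "y < b" and e: "e > 0"
  shows "norm (f y - f x) \<le> e"
proof -
  obtain N where N: "N \<in> null_sets lebesgue"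
    and N': "{x \<in> space lebesgue. \<not> (x \<in> {a<..<b} \<longrightarrow> (f has_vector_derivative 0) (at x))} \<subseteq> N"
    using ae unfolding eventually_ae_filter by blast
  obtain \<delta> where \<delta>: "\<delta> > 0" and ac': "\<And>(n::nat) l u.
        (\<And>i. i < n \<Longrightarrow> l i \<le> u i \<and> {l i..u i} \<subseteq> {a<..<b}) \<Longrightarrow>
        disjoint_family_on (\<lambda>i. {l i<..<u i}) {..<n} \<Longrightarrow>
        (\<Sum>i<n. u i - l i) < \<delta> \<Longrightarrow> (\<Sum>i<n. dist (f (l i)) (f (u i))) < e / 2"
    using abs_continuous_onD[OF ac, of "e/2"] e by auto
  obtain T where T: "open T" "N \<subseteq> T" "emeasure lebesgue (T - N) < ennreal \<delta>"
    using sets_lebesgue_outer_open[OF null_setsD2[OF N] \<delta>] by metis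
  have T_em: "emeasure lebesgue T < ennreal \<delta>"
    using T(3) emeasure_Diff_null_set[OF N, of T] T(1) by simp
  \<comment> \<open>Half of \<open>e\<close> is allotted to the cells tagged outside
    \<open>N\<close>, as a slope over the length \<open>y - x\<close>. The summand 1 keeps the
    denominator positive when \<open>x = y\<close>.\<close>
  define e' where "e' = e / 2 / (y - x + 1)"
  have e': "e' > 0" using e x by (simp add: e'_def)
  have "\<exists>d>0. \<forall>s. \<bar>s - t\<bar> < d \<longrightarrow> norm (f s - f t) \<le> e' * \<bar>s - t\<bar>" if "t \<in> {a<..<b} - N" for t
  proof -
    have "(f has_vector_derivative 0) (at t)" using that N' by auto
    then have "\<forall>e>0. \<exists>d>0. \<forall>s. norm (s - t) < d \<longrightarrow> norm (f s - f t - (s - t) *\<^sub>R 0) \<le> e * norm (s - t)"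
      unfolding has_vector_derivative_def has_derivative_at_alt by blast
    from this[rule_format, OF e'] show ?thesis by simp
  qed
  then obtain d where d: "\<And>t. t \<in> {a<..<b} - N \<Longrightarrow> d t > 0"
    "\<And>t s. t \<in> {a<..<b} - N \<Longrightarrow> \<bar>s - t\<bar> < d t \<Longrightarrow> norm (f s - f t) \<le> e' * \<bar>s - t\<bar>"
    by metis
  define g where "g = (\<lambda>t. if t \<in> N then T else if t \<in> {a<..<b} then ball t (d t) else UNIV)"
  have "gauge g" using T d(1) by (auto simp: gauge_def g_def)
  then obtain p where p: "p tagged_division_of {x..y}" "g fine p"
    using fine_division_exists_real by blast
  have fin: "finite p" using p by blast
  let ?F = "\<lambda>(t, K). f (Sup K) - f (Inf K)"
  have K: "\<exists>l u. K = {l..u} \<and> l \<le> t \<and> t \<le> u \<and> x \<le> l \<and> u \<le> y \<and> K \<subseteq> g t \<and> Inf K = l \<and> Sup K = u"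
    if tK: "(t, K) \<in> p" for t K
  proof -
    obtain l u where lu: "K = cbox l u"
      using tagged_division_ofD(4)[OF p(1) tK] by blast
    have "t \<in> K" "K \<subseteq> {x..y}" "K \<subseteq> g t"
      using tagged_division_ofD(2,3)[OF p(1) tK] p(2) tK unfolding fine_def by auto
    with lu have "l \<le> t" "t \<le> u" "x \<le> l" "u \<le> y" by auto
    with lu \<open>K \<subseteq> g t\<close> show ?thesis
      by (rule_tac x = l in exI, rule_tac x = u in exI) simp
  qed
  define P where "P = {q \<in> p. fst q \<in> N}"
  have P: "finite P" "P \<subseteq> p" using fin by (auto simp: P_def)
  have "norm (sum ?F (p - P)) \<le> (\<Sum>q\<in>p - P. e' * (Sup (snd q) - Inf (snd q)))"
  proof (rule sum_norm_le, clarify)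
    fix t K assume tK: "(t, K) \<in> p" "(t, K) \<notin> P"
    obtain l u where lu: "K = {l..u}" "l \<le> t" "t \<le> u" "x \<le> l" "u \<le> y" "K \<subseteq> g t" "Inf K = l" "Sup K = u"
      using K[OF tK(1)] by blast
    have t: "t \<in> {a<..<b} - N" using tK lu x by (auto simp: P_def)
    then have "K \<subseteq> ball t (d t)" using lu by (auto simp: g_def)
    moreover have "l \<in> K" "u \<in> K" using lu(1,2,3) by auto
    ultimately have "\<bar>l - t\<bar> < d t" "\<bar>u - t\<bar> < d t"
      by (auto simp: dist_real_def abs_minus_commute)
    then have "norm (f l - f t) \<le> e' * \<bar>l - t\<bar>" "norm (f u - f t) \<le> e' * \<bar>u - t\<bar>"
      using d(2)[OF t] by auto
    then have "norm (f u - f l) \<le> e' * \<bar>l - t\<bar> + e' * \<bar>u - t\<bar>"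
      using norm_triangle_ineq4[of "f u - f t" "f l - f t"] by simp
    also have "\<dots> = e' * (u - l)" using lu(2,3) by (simp add: algebra_simps)
    finally show "norm (f (Sup K) - f (Inf K)) \<le> e' * (Sup (snd (t, K)) - Inf (snd (t, K)))"
      using lu by simp
  qed
  also have "\<dots> \<le> (\<Sum>q\<in>p. e' * (Sup (snd q) - Inf (snd q)))"
  proof (rule sum_mono2[OF fin])
    fix q assume "q \<in> p - (p - P)"
    then have "(fst q, snd q) \<in> p" by auto
    from K[OF this] show "0 \<le> e' * (Sup (snd q) - Inf (snd q))" using e' by auto
  qed auto
  also have "\<dots> = e' * (\<Sum>(t,K)\<in>p. Sup K - Inf K)"
    by (simp add: sum_distrib_left case_prod_beta)
  also have "\<dots> = e' * (y - x)"
    using additive_tagged_division_1[OF x(2) p(1), of "\<lambda>x. x"] by simp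
  also have "\<dots> \<le> e / 2" using e x by (simp add: e'_def field_simps)
  finally have 1: "norm (sum ?F (p - P)) \<le> e / 2" .
  obtain h where h: "bij_betw h {..<card P} P"
    using ex_bij_betw_nat_finite[OF P(1)] by (auto simp: atLeast0LessThan)
  let ?l = "\<lambda>i. Inf (snd (h i))" and ?u = "\<lambda>i. Sup (snd (h i))"
  have hP: "(fst (h i), snd (h i)) \<in> p" "fst (h i) \<in> N" if "i < card P" for i
    using bij_betwE[OF h] that by (auto simp: P_def)
  have hK: "snd (h i) = {?l i..?u i}" "?l i \<le> ?u i" "x \<le> ?l i" "?u i \<le> y" "snd (h i) \<subseteq> T" if i: "i < card P" for i
    using K[OF hP(1)[OF i]] hP(2)[OF i] by (auto simp: g_def)
  have disj: "disjoint_family_on (\<lambda>i. {?l i<..<?u i}) {..<card P}"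
  proof (unfold disjoint_family_on_def, intro ballI impI)
    fix i j assume ij: "i \<in> {..<card P}" "j \<in> {..<card P}" "i \<noteq> j"
    then have "h i \<noteq> h j" using h by (auto simp: bij_betw_def inj_on_def)
    then have "interior (snd (h i)) \<inter> interior (snd (h j)) = {}"
      using tagged_division_ofD(5)[OF p(1) hP(1) hP(1), of i j] ij by (auto simp: prod_eq_iff)
    moreover have "interior (snd (h k)) = {?l k<..<?u k}" if "k < card P" for k
      by (subst hK(1)[OF that]) (rule interior_atLeastAtMost_real)
    ultimately show "{?l i<..<?u i} \<inter> {?l j<..<?u j} = {}" using ij by simp
  qed
  have "(\<Sum>i<card P. ?u i - ?l i) = (\<Sum>i<card P. measure lebesgue {?l i<..<?u i})"
    using hK(2) by (intro sum.cong) auto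
  also have "\<dots> = measure lebesgue (\<Union>i<card P. {?l i<..<?u i})"
    using disj hK(2) by (intro measure_finite_Union[symmetric]) auto
  also have "\<dots> < \<delta>"
  proof -
    have "{?l i<..<?u i} \<subseteq> T" if "i < card P" for i
      using hK(1,5)[OF that] by (metis greaterThanLessThan_subseteq_atLeastAtMost_iff order.trans order_refl)
    then have "emeasure lebesgue (\<Union>i<card P. {?l i<..<?u i}) \<le> emeasure lebesgue T"
      using T(1) by (intro emeasure_mono) auto
    then have "emeasure lebesgue (\<Union>i<card P. {?l i<..<?u i}) < ennreal \<delta>" using T_em by simp
    moreover from this have "emeasure lebesgue (\<Union>i<card P. {?l i<..<?u i}) \<noteq> \<infinity>" by auto
    ultimately show ?thesis
      using \<delta> by (metis emeasure_eq_ennreal_measure ennreal_less_iff infinity_ennreal_def measure_nonneg)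
  qed
  finally have len: "(\<Sum>i<card P. ?u i - ?l i) < \<delta>" .
  have "?l i \<le> ?u i \<and> {?l i..?u i} \<subseteq> {a<..<b}" if "i < card P" for i
    using hK(2-4)[OF that] x by auto
  then have "(\<Sum>i<card P. dist (f (?l i)) (f (?u i))) < e / 2"
    by (rule ac'[OF _ disj len])
  moreover have "norm (sum ?F P) \<le> (\<Sum>i<card P. dist (f (?l i)) (f (?u i)))"
  proof -
    have "sum ?F P = (\<Sum>i<card P. ?F (h i))" by (rule sum.reindex_bij_betw[OF h, symmetric])
    also have "norm \<dots> \<le> (\<Sum>i<card P. dist (f (?l i)) (f (?u i)))"
      by (rule sum_norm_le) (auto simp: case_prod_beta dist_norm norm_minus_commute)
    finally show ?thesis .
  qed
  ultimately have 2: "norm (sum ?F P) \<le> e / 2" by simp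
  have "f y - f x = sum ?F p" using additive_tagged_division_1[OF x(2) p(1), of f] by simp
  also have "\<dots> = sum ?F (p - P) + sum ?F P" using P fin by (simp add: sum.subset_diff)
  finally show ?thesis using 1 2 norm_triangle_ineq[of "sum ?F (p - P)" "sum ?F P"] by simp
qed

lemma abs_continuous_derivative_zero_imp_const:
  fixes f :: "real \<Rightarrow> 'a::real_normed_vector"
  assumes ac: "abs_continuous_on {a<..<b} f"
    and ae: "AE x in lebesgue. x \<in> {a<..<b} \<longrightarrow> (f has_vector_derivative 0) (at x)"
    and xy: "x \<in> {a<..<b}" "y \<in> {a<..<b}"
  shows "f x = f y"
proof -
  have "f u = f v" if "a < u" "u \<le> v" "v < b" for u v
  proof -
    have "norm (f v - f u) \<le> 0"
    proof (rule field_le_epsilon)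
      fix e :: real assume "e > 0"
      then show "norm (f v - f u) \<le> 0 + e"
        using abs_continuous_derivative_zero_le[OF ac ae that] by simp
    qed
    then show ?thesis by simp
  qed
  then show ?thesis using xy by (metis greaterThanLessThan_iff linear)
qed

text \<open>Subtracting a primitive of a continuous function, which is Lipschitz, reduces statements
  about a known derivative to the case of derivative zero.\<close>

lemma abs_continuous_on_diff_lipschitz:
  fixes f g :: "real \<Rightarrow> 'a::real_normed_vector"
  assumes f: "abs_continuous_on S f"
    and g: "\<And>x y. x \<in> S \<Longrightarrow> y \<in> S \<Longrightarrow> norm (g x - g y) \<le> L * \<bar>x - y\<bar>"
  shows "abs_continuous_on S (\<lambda>x. f x - g x)"
  unfolding abs_continuous_on_def
proof (intro allI impI)
  fix \<epsilon> :: real assume \<epsilon>: "\<epsilon> > 0"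
  obtain \<delta> where \<delta>: "\<delta> > 0" and ac: "\<And>(n::nat) a b.
        (\<And>i. i < n \<Longrightarrow> a i \<le> b i \<and> {a i..b i} \<subseteq> S) \<Longrightarrow>
        disjoint_family_on (\<lambda>i. {a i<..<b i}) {..<n} \<Longrightarrow>
        (\<Sum>i<n. b i - a i) < \<delta> \<Longrightarrow> (\<Sum>i<n. dist (f (a i)) (f (b i))) < \<epsilon> / 2"
    using abs_continuous_onD[OF f, of "\<epsilon>/2"] \<epsilon> by auto
  \<comment> \<open>\<open>L\<close> may be zero or negative, while the choice of
    \<open>\<delta>\<close> divides by it.\<close>
  define L' where "L' = max L 1"
  have L': "L \<le> L'" "L' > 0" by (auto simp: L'_def)
  show "\<exists>\<delta>>0. \<forall>(n::nat) a b.
        (\<forall>i<n. a i \<le> b i \<and> {a i..b i} \<subseteq> S) \<and>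
        disjoint_family_on (\<lambda>i. {a i<..<b i}) {..<n} \<and>
        (\<Sum>i<n. b i - a i) < \<delta> \<longrightarrow>
        (\<Sum>i<n. dist (f (a i) - g (a i)) (f (b i) - g (b i))) < \<epsilon>"
  proof (intro exI[of _ "min \<delta> (\<epsilon> / 2 / L')"] conjI allI impI; (elim conjE)?)
    show "0 < min \<delta> (\<epsilon> / 2 / L')" using \<delta> \<epsilon> L' by simp
    fix n :: nat and a b :: "nat \<Rightarrow> real"
    assume ab: "\<forall>i<n. a i \<le> b i \<and> {a i..b i} \<subseteq> S" "disjoint_family_on (\<lambda>i. {a i<..<b i}) {..<n}"
      "(\<Sum>i<n. b i - a i) < min \<delta> (\<epsilon> / 2 / L')"
    have "dist (f (a i) - g (a i)) (f (b i) - g (b i)) \<le> dist (f (a i)) (f (b i)) + L' * (b i - a i)" if "i < n" for i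
    proof -
      have ab': "a i \<le> b i" "{a i..b i} \<subseteq> S" using ab(1) that by auto
      then have "a i \<in> S" "b i \<in> S" by auto
      then have "norm (g (a i) - g (b i)) \<le> L * (b i - a i)" using g[of "a i" "b i"] ab'(1) by simp
      also have "\<dots> \<le> L' * (b i - a i)" using L' ab' by (simp add: mult_right_mono)
      finally show ?thesis
        using norm_triangle_ineq4[of "f (a i) - f (b i)" "g (a i) - g (b i)"]
        by (simp add: dist_norm algebra_simps)
    qed
    then have "(\<Sum>i<n. dist (f (a i) - g (a i)) (f (b i) - g (b i)))
        \<le> (\<Sum>i<n. dist (f (a i)) (f (b i)) + L' * (b i - a i))"
      by (intro sum_mono) auto
    also have "\<dots> = (\<Sum>i<n. dist (f (a i)) (f (b i))) + L' * (\<Sum>i<n. b i - a i)"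
      by (simp add: sum.distrib sum_distrib_left)
    also have "\<dots> < \<epsilon> / 2 + \<epsilon> / 2"
      using ac[of n a b] ab L' by (intro add_strict_mono) (auto simp: field_simps)
    finally show "(\<Sum>i<n. dist (f (a i) - g (a i)) (f (b i) - g (b i))) < \<epsilon>" by simp
  qed
qed

lemma lipschitz_imp_abs_continuous_on:
  fixes g :: "real \<Rightarrow> 'a::real_normed_vector"
  assumes "\<And>x y. x \<in> S \<Longrightarrow> y \<in> S \<Longrightarrow> norm (g x - g y) \<le> L * \<bar>x - y\<bar>"
  shows "abs_continuous_on S g"
proof -
  have "abs_continuous_on S (\<lambda>x. 0 :: 'a)"
    by (auto simp: abs_continuous_on_def intro: exI[of _ 1])
  moreover have "norm (- g x - - g y) \<le> L * \<bar>x - y\<bar>" if "x \<in> S" "y \<in> S" for x y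
    using assms[OF that] by (simp add: norm_minus_commute)
  ultimately show ?thesis
    using abs_continuous_on_diff_lipschitz[of S "\<lambda>x. 0" "\<lambda>x. - g x" L] by auto
qed

subsection \<open>The iterated integral series\<close>

text \<open>Termwise differentiation in the space variable. It is local, to be applied on a small
  ball that avoids the discontinuities of the weights.\<close>

lemma has_vector_derivative_suminf:
  fixes f :: "nat \<Rightarrow> real \<Rightarrow> 'a::banach"
  assumes I: "open I" "convex I" "x \<in> I"
    and f': "\<And>n t. t \<in> I \<Longrightarrow> (f n has_vector_derivative f' n t) (at t)"
    and M: "\<And>n t. t \<in> I \<Longrightarrow> norm (f n t) \<le> M n" "summable M"
    and M': "\<And>n t. t \<in> I \<Longrightarrow> norm (f' n t) \<le> M' n" "summable M'"
  shows "((\<lambda>t. \<Sum>n. f n t) has_vector_derivative (\<Sum>n. f' n x)) (at x)"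
proof -
  have ul: "uniform_limit I (\<lambda>n t. \<Sum>i<n. f' i t) (\<lambda>t. \<Sum>n. f' n t) sequentially"
    using M' by (intro Weierstrass_m_test) auto
  have sf: "summable (\<lambda>n. f n t)" if "t \<in> I" for t
    using M that by (intro summable_comparison_test[OF _ M(2)]) auto
  have "\<exists>g. \<forall>t\<in>I. (\<lambda>n. f n t) sums (g t) \<and>
      (g has_derivative (\<lambda>h. h *\<^sub>R (\<Sum>n. f' n t))) (at t within I)"
  proof (rule has_derivative_series[OF I(2) _ _ I(3)])
    show "(f n has_derivative (\<lambda>h. h *\<^sub>R f' n t)) (at t within I)" if "t \<in> I" for n t
      using f'[OF that] has_derivative_at_withinI unfolding has_vector_derivative_def by blast
    show "(\<lambda>n. f n x) sums (\<Sum>n. f n x)" using sf[OF I(3)] by (rule summable_sums)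
    fix e :: real assume e: "e > 0"
    have "\<forall>\<^sub>F n in sequentially. \<forall>t\<in>I. dist (\<Sum>i<n. f' i t) (\<Sum>n. f' n t) < e"
      using ul e unfolding uniform_limit_iff by blast
    then show "\<forall>\<^sub>F n in sequentially. \<forall>t\<in>I. \<forall>h. norm ((\<Sum>i<n. h *\<^sub>R f' i t) - h *\<^sub>R (\<Sum>n. f' n t)) \<le> e * norm h"
    proof (eventually_elim, intro ballI allI)
      fix n t h assume "\<forall>t\<in>I. dist (\<Sum>i<n. f' i t) (\<Sum>n. f' n t) < e" "t \<in> I"
      then have "norm ((\<Sum>i<n. f' i t) - (\<Sum>n. f' n t)) \<le> e" by (auto simp: dist_norm less_imp_le)
      then have "\<bar>h\<bar> * norm ((\<Sum>i<n. f' i t) - (\<Sum>n. f' n t)) \<le> \<bar>h\<bar> * e" by (intro mult_left_mono) auto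
      then show "norm ((\<Sum>i<n. h *\<^sub>R f' i t) - h *\<^sub>R (\<Sum>n. f' n t)) \<le> e * norm h"
        by (simp add: scaleR_sum_right[symmetric] scaleR_diff_right[symmetric] mult.commute)
    qed
  qed
  then obtain g where g: "\<And>t. t \<in> I \<Longrightarrow> (\<lambda>n. f n t) sums (g t)"
    "\<And>t. t \<in> I \<Longrightarrow> (g has_derivative (\<lambda>h. h *\<^sub>R (\<Sum>n. f' n t))) (at t within I)" by blast
  have "((\<lambda>t. \<Sum>n. f n t) has_derivative (\<lambda>h. h *\<^sub>R (\<Sum>n. f' n x))) (at x within I)"
    by (rule has_derivative_transform[OF I(3) _ g(2)[OF I(3)]]) (use g(1) in \<open>simp add: sums_iff\<close>)
  then show ?thesis
    unfolding has_vector_derivative_def at_within_open[OF I(3,1)] .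
qed

text \<open>Iterated integrals with alternating weights \<open>a, b, a, \<dots>\<close>, innermost first; these are the
  Taylor coefficients in \<open>s\<close> of the solutions of \<open>o' = s a e\<close>, \<open>e' = s b o\<close>.\<close>

fun iter_int :: "(real \<Rightarrow> real) \<Rightarrow> (real \<Rightarrow> real) \<Rightarrow> real \<Rightarrow> nat \<Rightarrow> real \<Rightarrow> real" where
  "iter_int a b c 0 x = 1"
| "iter_int a b c (Suc n) x = integral {c..x} (\<lambda>t. (if even n then a t else b t) * iter_int a b c n t)"

text \<open>One alternating family serves both unknowns: its even part is \<open>e\<close> with
  \<open>e(c) = 1\<close>, its odd part is \<open>o\<close> with \<open>o(c) = 0\<close>. Selecting
  by a flag instead of reindexing makes the two differential equations a single statement, in which
  \<open>p\<close> is negated, and the behaviour under a change of sign of \<open>s\<close>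
  immediate.\<close>

definition parity_series ::
  "bool \<Rightarrow> (real \<Rightarrow> real) \<Rightarrow> (real \<Rightarrow> real) \<Rightarrow> real \<Rightarrow> complex \<Rightarrow> real \<Rightarrow> complex" where
  "parity_series p a b c s x = (\<Sum>n. of_real (if even n = p then iter_int a b c n x else 0) * s ^ n)"

locale weights =
  fixes a b :: "real \<Rightarrow> real" and S :: "real set" and B c d :: real
  assumes cd: "c < d" and finS: "finite S"
    and bnd: "\<And>x. \<bar>a x\<bar> \<le> B" "\<And>x. \<bar>b x\<bar> \<le> B"
    and cont: "\<And>x. x \<notin> S \<Longrightarrow> isCont a x" "\<And>x. x \<notin> S \<Longrightarrow> isCont b x"
begin

lemma B_nonneg: "0 \<le> B" using bnd(1)[of 0] by linarith

lemma weighted_integrable: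
  fixes f :: "real \<Rightarrow> real"
  assumes "w = a \<or> w = b" and f: "continuous_on {c..d} f" and x: "x \<in> {c..d}"
  shows "(\<lambda>t. w t * f t) integrable_on {c..x}"
proof -
  have fx: "continuous_on {c..x} f" using continuous_on_subset[OF f] x by auto
  have w: "\<And>t. t \<notin> S \<Longrightarrow> isCont w t" "\<And>t. \<bar>w t\<bar> \<le> B" using assms(1) bnd cont by auto
  have "compact (f ` {c..x})" using fx by (intro compact_continuous_image) auto
  then obtain F where F: "\<And>t. t \<in> {c..x} \<Longrightarrow> \<bar>f t\<bar> \<le> F"
    using compact_imp_bounded[of "f ` {c..x}"] unfolding bounded_iff by fastforce
  have "(\<lambda>t. w t * f t) absolutely_integrable_on ({c..x} - S)"
  proof (rule measurable_bounded_by_integrable_imp_absolutely_integrable)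
    have "S \<in> sets lborel" using finS by (simp add: finite_imp_closed borel_closed)
    then have "{c..x} - S \<in> sets lebesgue" by auto
    moreover have "continuous_on ({c..x} - S) (\<lambda>t. w t * f t)"
      using w(1) continuous_on_subset[OF fx, of "{c..x} - S"]
      by (intro continuous_on_mult[OF continuous_at_imp_continuous_on]) auto
    ultimately show "(\<lambda>t. w t * f t) \<in> borel_measurable (lebesgue_on ({c..x} - S))"
      "{c..x} - S \<in> sets lebesgue"
      using continuous_imp_measurable_on_sets_lebesgue by auto
    have "(\<lambda>t. B * F) integrable_on {c..x}" by (simp add: integrable_const_ivl)
    then show "(\<lambda>t. B * F) integrable_on ({c..x} - S)"
      by (rule integrable_spike_set) (use finS in \<open>auto intro!: negligible_finite intro: finite_subset[OF _ finS]\<close>)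
    show "norm (w t * f t) \<le> B * F" if "t \<in> {c..x} - S" for t
      using w(2)[of t] F[of t] that B_nonneg by (auto simp: abs_mult intro!: mult_mono)
  qed
  then have "(\<lambda>t. w t * f t) integrable_on ({c..x} - S)"
    using absolutely_integrable_on_def by blast
  then show ?thesis
    by (rule integrable_spike_set) (auto intro!: negligible_finite intro: finite_subset[OF _ finS])
qed

text \<open>Joint induction: the bound for the next integral needs integrability of the present one,
  which rests on its continuity. The factorial comes from integrating powers of \<open>x - c\<close>
  and makes the series entire in \<open>s\<close>.\<close>

lemma iter_int_props:
  "continuous_on {c..d} (iter_int a b c n) \<and>
   (\<forall>x\<in>{c..d}. \<bar>iter_int a b c n x\<bar> \<le> (B * (x - c)) ^ n / fact n)"
proof (induction n)
  case (Suc n)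
  define w where "w = (if even n then a else b)"
  have w: "w = a \<or> w = b" by (simp add: w_def)
  have eq: "iter_int a b c (Suc n) = (\<lambda>x. integral {c..x} (\<lambda>t. w t * iter_int a b c n t))"
    by (auto simp: w_def fun_eq_iff)
  have int: "(\<lambda>t. w t * iter_int a b c n t) integrable_on {c..x}" if "x \<in> {c..d}" for x
    using weighted_integrable[OF w _ that] Suc.IH by blast
  have "\<bar>iter_int a b c (Suc n) x\<bar> \<le> (B * (x - c)) ^ Suc n / fact (Suc n)" if x: "x \<in> {c..d}" for x
  proof -
    have "((\<lambda>t. B * ((B * (t - c)) ^ n / fact n)) has_integral
        (B * (x - c)) ^ Suc n / fact (Suc n) - (B * (c - c)) ^ Suc n / fact (Suc n)) {c..x}"
    proof (rule fundamental_theorem_of_calculus)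
      fix t assume "t \<in> {c..x}"
      have "((\<lambda>t. (B * (t - c)) ^ Suc n / fact (Suc n)) has_real_derivative
          (B * ((B * (t - c)) ^ n / fact n))) (at t within {c..x})"
        by (rule derivative_eq_intros refl | simp del: of_nat_Suc add: field_simps)+
      then show "((\<lambda>t. (B * (t - c)) ^ Suc n / fact (Suc n)) has_vector_derivative
          (B * ((B * (t - c)) ^ n / fact n))) (at t within {c..x})"
        by (simp add: has_real_derivative_iff_has_vector_derivative)
    qed (use x in auto)
    then have hi: "((\<lambda>t. B * ((B * (t - c)) ^ n / fact n)) has_integral
        (B * (x - c)) ^ Suc n / fact (Suc n)) {c..x}" by simp
    have "norm (integral {c..x} (\<lambda>t. w t * iter_int a b c n t)) \<le>
        integral {c..x} (\<lambda>t. B * ((B * (t - c)) ^ n / fact n))"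
    proof (rule integral_norm_bound_integral[OF int[OF x]])
      show "(\<lambda>t. B * ((B * (t - c)) ^ n / fact n)) integrable_on {c..x}" using hi by blast
      fix t assume t: "t \<in> {c..x}"
      have "\<bar>w t\<bar> \<le> B" using w bnd by auto
      then show "norm (w t * iter_int a b c n t) \<le> B * ((B * (t - c)) ^ n / fact n)"
        unfolding norm_mult using Suc.IH t x B_nonneg by (intro mult_mono) auto
    qed
    then show ?thesis unfolding eq integral_unique[OF hi] by simp
  qed
  moreover have "continuous_on {c..d} (iter_int a b c (Suc n))"
    unfolding eq using int cd by (intro indefinite_integral_continuous_1) auto
  ultimately show ?case by blast
qed auto

lemma iter_int_bound:
  assumes "x \<in> {c..d}"
  shows "\<bar>iter_int a b c n x\<bar> \<le> (B * (d - c)) ^ n / fact n"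
proof -
  have "\<bar>iter_int a b c n x\<bar> \<le> (B * (x - c)) ^ n / fact n" using iter_int_props assms by blast
  also have "\<dots> \<le> (B * (d - c)) ^ n / fact n"
    using assms B_nonneg by (intro divide_right_mono power_mono mult_left_mono mult_nonneg_nonneg) auto
  finally show ?thesis .
qed

lemma iter_int_deriv:
  assumes x: "x \<in> {c<..<d} - S"
  shows "(iter_int a b c (Suc n) has_vector_derivative
    ((if even n then a x else b x) * iter_int a b c n x)) (at x)"
proof -
  define w where "w = (if even n then a else b)"
  have w: "w = a \<or> w = b" by (simp add: w_def)
  have eq: "iter_int a b c (Suc n) = (\<lambda>x. integral {c..x} (\<lambda>t. w t * iter_int a b c n t))"
    by (auto simp: w_def fun_eq_iff)
  have cont': "continuous_on {c..d} (iter_int a b c n)" using iter_int_props by blast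
  then have "isCont (iter_int a b c n) x"
    using x by (simp add: continuous_on_interior)
  moreover have "isCont w x" using w x cont by auto
  ultimately have "isCont (\<lambda>t. w t * iter_int a b c n t) x" by (intro isCont_mult)
  then have "((\<lambda>x. integral {c..x} (\<lambda>t. w t * iter_int a b c n t)) has_vector_derivative
      w x * iter_int a b c n x) (at x within ({c..d} - {}))"
    using weighted_integrable[OF w cont'] x cd
    by (intro integral_has_vector_derivative_continuous_at) (auto intro: continuous_at_imp_continuous_at_within)
  then show ?thesis
    using x by (simp add: eq w_def at_within_Icc_at split: if_splits)
qed

lemma term_bound:
  assumes "x \<in> {c..d}"
  shows "norm (complex_of_real (if even n = p then iter_int a b c n x else 0) * s ^ n)
    \<le> (B * (d - c) * norm s) ^ n / fact n"
proof -
  have "norm (complex_of_real (if even n = p then iter_int a b c n x else 0)) \<le> (B * (d - c)) ^ n / fact n"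
    using iter_int_bound[OF assms, of n] by (auto split: if_splits)
  then have "norm (complex_of_real (if even n = p then iter_int a b c n x else 0)) * norm s ^ n
    \<le> (B * (d - c)) ^ n / fact n * norm s ^ n" by (intro mult_right_mono) auto
  then show ?thesis by (simp add: norm_mult norm_power power_mult_distrib)
qed

lemma summable_bound: "summable (\<lambda>n. (B * (d - c) * norm (s::complex)) ^ n / fact n)"
  using summable_exp[of "B * (d - c) * norm s"] by (simp add: divide_inverse mult.commute)

lemma summable_term:
  assumes "x \<in> {c..d}"
  shows "summable (\<lambda>n. complex_of_real (if even n = p then iter_int a b c n x else 0) * s ^ n)"
  using term_bound[OF assms] by (intro summable_comparison_test[OF _ summable_bound]) blast

lemma parity_series_continuous: "continuous_on {c..d} (parity_series p a b c s)"
proof -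
  have "uniform_limit {c..d}
      (\<lambda>N x. \<Sum>n<N. complex_of_real (if even n = p then iter_int a b c n x else 0) * s ^ n)
      (parity_series p a b c s) sequentially"
    unfolding parity_series_def
    by (rule Weierstrass_m_test[OF _ summable_bound]) (rule term_bound)
  moreover have "continuous_on {c..d}
      (\<lambda>x. \<Sum>n<N. complex_of_real (if even n = p then iter_int a b c n x else 0) * s ^ n)" for N
  proof (intro continuous_on_sum continuous_on_mult continuous_on_of_real)
    show "continuous_on {c..d} (\<lambda>x. if even n = p then iter_int a b c n x else 0)" for n
      using iter_int_props by (cases "even n = p") auto
  qed auto
  ultimately show ?thesis
    by (intro uniform_limit_theorem) auto
qed

text \<open>The derivative at 0 is recorded because, for the odd part, it is the integral of the
  first weight. From this integral the medium is recovered in the end.\<close>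

lemma parity_series_holomorphic:
  assumes "x \<in> {c..d}"
  shows "(\<lambda>s. parity_series p a b c s x) holomorphic_on UNIV"
    and "((\<lambda>s. parity_series p a b c s x) has_field_derivative
          of_real (if p then 0 else iter_int a b c 1 x)) (at 0)"
proof -
  define C where "C n = complex_of_real (if even n = p then iter_int a b c n x else 0)" for n
  have D: "((\<lambda>s. parity_series p a b c s x) has_field_derivative (\<Sum>n. diffs C n * s ^ n)) (at s)" for s
    unfolding parity_series_def C_def[symmetric]
    by (rule termdiffs_strong_converges_everywhere) (use summable_term[OF assms] C_def in auto)
  then show "(\<lambda>s. parity_series p a b c s x) holomorphic_on UNIV"
    using holomorphic_on_open by blast
  have "(\<Sum>n. diffs C n * 0 ^ n) = diffs C 0" by (rule powser_zero)
  then show "((\<lambda>s. parity_series p a b c s x) has_field_derivative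
          of_real (if p then 0 else iter_int a b c 1 x)) (at 0)"
    using D[of 0] by (simp add: diffs_def C_def del: iter_int.simps split: if_splits)
qed

lemma parity_series_0: "parity_series p a b c 0 x = (if p then 1 else 0)"
  unfolding parity_series_def by (subst powser_zero) auto

lemma parity_series_minus:
  assumes "x \<in> {c..d}"
  shows "parity_series p a b c (- s) x = (if p then 1 else -1) * parity_series p a b c s x"
proof -
  have "complex_of_real (if even n = p then iter_int a b c n x else 0) * (- s) ^ n =
     (if p then 1 else -1) * (complex_of_real (if even n = p then iter_int a b c n x else 0) * s ^ n)" for n
    by (cases "even n") auto
  then show ?thesis
    unfolding parity_series_def by (simp only: suminf_mult[OF summable_term[OF assms]])
qed

lemma parity_series_start: "parity_series p a b c s c = (if p then 1 else 0)"
proof -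
  have "iter_int a b c n c = (if n = 0 then 1 else 0)" for n by (cases n) auto
  then have "(\<lambda>n. complex_of_real (if even n = p then iter_int a b c n c else 0) * s ^ n) =
     (\<lambda>n. (if n = 0 then (if p then 1 else 0) else 0) * s ^ n)" by (auto simp: fun_eq_iff)
  then show ?thesis unfolding parity_series_def
    using powser_zero[of "\<lambda>n. if n = 0 then (if p then 1 else 0) else 0 :: complex"]
      suminf_finite[of "{0}" "\<lambda>n. (if n = 0 then (if p then 1 else 0) else 0) * s ^ n"] by auto
qed

lemma parity_series_deriv:
  assumes x: "x \<in> {c<..<d} - S"
  shows "(parity_series p a b c s has_vector_derivative
    s * of_real (if p then b x else a x) * parity_series (\<not> p) a b c s x) (at x)"
proof -
  have "open ({c<..<d} - S)" by (intro open_Diff finite_imp_closed finS) auto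
  from openE[OF this x] obtain e where e: "e > 0" "ball x e \<subseteq> {c<..<d} - S" .
  define f where "f n t = complex_of_real (if even n = p then iter_int a b c n t else 0) * s ^ n" for n t
  \<comment> \<open>Differentiation removes the outermost integral: the index drops by one, the
    parity flips, and one factor \<open>s\<close> and the outer weight come out. The constant term
    is treated apart, since \<open>n - 1\<close> is 0 there.\<close>
  define f' where "f' n t = (if n = 0 then 0 else complex_of_real (if even n = p then
     (if even (n - 1) then a t else b t) * iter_int a b c (n - 1) t else 0) * s ^ n)" for n t
  have f': "f' (Suc n) t = s * of_real (if p then b t else a t) *
      (complex_of_real (if even n = (\<not> p) then iter_int a b c n t else 0) * s ^ n)" for n t
    by (cases "even n"; cases p) (auto simp: f'_def)
  have "((\<lambda>t. \<Sum>n. f n t) has_vector_derivative (\<Sum>n. f' n x)) (at x)"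
  proof (rule has_vector_derivative_suminf[OF _ _ _ _ _ summable_bound])
    show "open (ball x e)" "convex (ball x e)" "x \<in> ball x e" using e by auto
    fix n t assume "t \<in> ball x e"
    then have t: "t \<in> {c<..<d} - S" using e by blast
    show "norm (f n t) \<le> (B * (d - c) * norm s) ^ n / fact n"
      unfolding f_def using t by (intro term_bound) auto
    show "(f n has_vector_derivative f' n t) (at t)"
    proof (cases n)
      case 0
      then show ?thesis by (cases p) (simp_all add: f_def[abs_def] f'_def)
    next
      case (Suc k)
      have "((\<lambda>t. complex_of_real (iter_int a b c (Suc k) t)) has_vector_derivative
          complex_of_real ((if even k then a t else b t) * iter_int a b c k t)) (at t)"
        using iter_int_deriv[OF t] has_vector_derivative_of_real has_real_derivative_iff_has_vector_derivative by blast
      from has_vector_derivative_mult_left[OF this, of "s ^ n"] show ?thesis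
        by (cases "even n = p") (auto simp: f_def[abs_def] f'_def Suc simp del: iter_int.simps)
    qed
    show "norm (f' n t) \<le> (case n of 0 \<Rightarrow> 0 | Suc k \<Rightarrow> norm s * B * ((B * (d - c) * norm s) ^ k / fact k))"
    proof (cases n)
      case 0
      then show ?thesis by (simp add: f'_def)
    next
      case (Suc k)
      have "\<bar>if p then b t else a t\<bar> \<le> B" using bnd by auto
      moreover have "norm (complex_of_real (if even k = (\<not> p) then iter_int a b c k t else 0) * s ^ k)
          \<le> (B * (d - c) * norm s) ^ k / fact k" using t by (intro term_bound) auto
      ultimately have "norm s * \<bar>if p then b t else a t\<bar> *
          norm (complex_of_real (if even k = (\<not> p) then iter_int a b c k t else 0) * s ^ k)
          \<le> norm s * B * ((B * (d - c) * norm s) ^ k / fact k)"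
        using B_nonneg by (intro mult_mono) auto
      then show ?thesis unfolding Suc f' by (simp add: norm_mult)
    qed
  next
    show "summable (\<lambda>n. case n of 0 \<Rightarrow> 0 | Suc k \<Rightarrow> norm s * B * ((B * (d - c) * norm s) ^ k / fact k))"
      using summable_mult[OF summable_bound] by (subst summable_Suc_iff[symmetric]) simp
  qed
  moreover have "(\<Sum>n. f' n x) = s * of_real (if p then b x else a x) * parity_series (\<not> p) a b c s x"
  proof -
    have sm: "summable (\<lambda>n. complex_of_real (if even n = (\<not> p) then iter_int a b c n x else 0) * s ^ n)"
      using x by (intro summable_term) auto
    have "summable (\<lambda>n. f' (Suc n) x)" unfolding f' by (rule summable_mult[OF sm])
    then have "summable (\<lambda>n. f' n x)" by (rule summable_Suc_iff[THEN iffD1])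
    then have "(\<Sum>n. f' n x) = (\<Sum>n. f' (Suc n) x) + f' 0 x"
      using suminf_split_head[of "\<lambda>n. f' n x"] by simp
    also have "\<dots> = s * of_real (if p then b x else a x) * parity_series (\<not> p) a b c s x"
      unfolding f' parity_series_def by (subst suminf_mult[OF sm]) (simp add: f'_def)
    finally show ?thesis .
  qed
  ultimately show ?thesis by (simp add: parity_series_def[abs_def] f_def)
qed

end

subsection \<open>The first-order system and its energy\<close>

text \<open>The first-order form of \<open>(\<zeta> u')' + \<omega>\<^sup>2 \<zeta> u = 0\<close> with \<open>s = \<i> \<omega>\<close> and \<open>z = \<zeta> u' / s\<close>.\<close>

definition system_on ::
  "real set \<Rightarrow> real set \<Rightarrow> (real \<Rightarrow> real) \<Rightarrow> complex \<Rightarrow> (real \<Rightarrow> complex) \<Rightarrow> (real \<Rightarrow> complex) \<Rightarrow> bool" where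
  "system_on I S r s u z \<longleftrightarrow> continuous_on I u \<and> continuous_on I z \<and>
     (\<forall>x\<in>interior I - S. (u has_vector_derivative s * z x / of_real (r x)) (at x) \<and>
        (z has_vector_derivative s * of_real (r x) * u x) (at x))"

lemma system_on_subset: "system_on I S r s u z \<Longrightarrow> J \<subseteq> I \<Longrightarrow> system_on J S r s u z"
  unfolding system_on_def using continuous_on_subset interior_mono by blast

lemma system_on_combine:
  assumes "system_on I S r s u1 z1" "system_on I S r s u2 z2"
  shows "system_on I S r s (\<lambda>x. k * u1 x + l * u2 x) (\<lambda>x. k * z1 x + l * z2 x)"
  unfolding system_on_def
proof (intro conjI ballI)
  fix x assume x: "x \<in> interior I - S"
  have "((\<lambda>x. k * u1 x + l * u2 x) has_vector_derivative
      k * (s * z1 x / of_real (r x)) + l * (s * z2 x / of_real (r x))) (at x)"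
    using assms x unfolding system_on_def
    by (intro has_vector_derivative_add has_vector_derivative_mult_right) auto
  then show "((\<lambda>x. k * u1 x + l * u2 x) has_vector_derivative s * (k * z1 x + l * z2 x) / of_real (r x)) (at x)"
    by (rule back_subst[of "\<lambda>d. (_ has_vector_derivative d) _"]) (simp add: add_divide_distrib algebra_simps)
  have "((\<lambda>x. k * z1 x + l * z2 x) has_vector_derivative
      k * (s * of_real (r x) * u1 x) + l * (s * of_real (r x) * u2 x)) (at x)"
    using assms x unfolding system_on_def
    by (intro has_vector_derivative_add has_vector_derivative_mult_right) auto
  then show "((\<lambda>x. k * z1 x + l * z2 x) has_vector_derivative s * of_real (r x) * (k * u1 x + l * u2 x)) (at x)"
    by (rule back_subst[of "\<lambda>d. (_ has_vector_derivative d) _"]) (simp add: algebra_simps)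
qed (use assms in \<open>auto simp: system_on_def intro!: continuous_intros\<close>)

text \<open>Continuity across the exceptional points is all that the fundamental theorem of calculus
  asks for. This is why the system carries \<open>z\<close>, which has no jumps.\<close>

lemma antimono_finite_exceptions:
  fixes f :: "real \<Rightarrow> real"
  assumes "finite S" "a \<le> b" "continuous_on {a..b} f"
    and f': "\<And>x. x \<in> {a<..<b} - S \<Longrightarrow> (f has_vector_derivative f' x) (at x) \<and> f' x \<le> 0"
  shows "f b \<le> f a"
proof -
  let ?g = "\<lambda>x. if x \<in> {a<..<b} - S then f' x else 0"
  have "(?g has_integral (f b - f a)) {a..b}"
    using assms by (intro fundamental_theorem_of_calculus_interior_strong[of S]) auto
  moreover have "((\<lambda>x. 0) has_integral (0::real)) {a..b}" by simp
  ultimately have "f b - f a \<le> 0"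
    by (rule has_integral_le) (use f' in auto)
  then show ?thesis by simp
qed

text \<open>The coefficient matrix of the system has trace zero.\<close>

lemma wronskian_const:
  assumes "finite S" "system_on I S r s u1 z1" "system_on I S r s u2 z2" "{x..y} \<subseteq> I" "x \<le> y"
  shows "u1 x * z2 x - z1 x * u2 x = u1 y * z2 y - z1 y * u2 y"
proof -
  have sol: "system_on {x..y} S r s u1 z1" "system_on {x..y} S r s u2 z2"
    using assms system_on_subset by blast+
  have "((\<lambda>t. 0) has_integral (u1 y * z2 y - z1 y * u2 y) - (u1 x * z2 x - z1 x * u2 x)) {x..y}"
  proof (rule fundamental_theorem_of_calculus_interior_strong[OF assms(1,5)])
    fix t assume t: "t \<in> {x<..<y} - S"
    have D: "(u1 has_vector_derivative s * z1 t / of_real (r t)) (at t)"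
      "(z1 has_vector_derivative s * of_real (r t) * u1 t) (at t)"
      "(u2 has_vector_derivative s * z2 t / of_real (r t)) (at t)"
      "(z2 has_vector_derivative s * of_real (r t) * u2 t) (at t)"
      using sol t unfolding system_on_def by auto
    show "((\<lambda>t. u1 t * z2 t - z1 t * u2 t) has_vector_derivative 0) (at t)"
      using has_vector_derivative_diff[OF has_vector_derivative_mult[OF D(1,4)] has_vector_derivative_mult[OF D(2,3)]]
      by (simp add: algebra_simps)
  next
    show "continuous_on {x..y} (\<lambda>t. u1 t * z2 t - z1 t * u2 t)"
      using sol unfolding system_on_def by (intro continuous_intros) auto
  qed
  then show ?thesis by (auto simp: has_integral_0_eq)
qed

text \<open>Cramer's rule, with coefficients that are Wronskians and hence constant. It plays the
  role of a uniqueness theorem for initial values, and it also works on an open interval, where a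
  solution has no prescribed end values.\<close>

lemma system_on_represent:
  assumes S: "finite S" and ivl: "is_interval I"
    and sol: "system_on I S r s u z" "system_on I S r s u1 z1" "system_on I S r s u2 z2"
    and det: "\<And>x. x \<in> I \<Longrightarrow> u1 x * z2 x - z1 x * u2 x = 1"
  obtains k l where "\<And>x. x \<in> I \<Longrightarrow> u x = k * u1 x + l * u2 x"
    "\<And>x. x \<in> I \<Longrightarrow> z x = k * z1 x + l * z2 x"
proof -
  let ?k = "\<lambda>x. u x * z2 x - z x * u2 x" and ?l = "\<lambda>x. u1 x * z x - z1 x * u x"
  have kl: "?k x = ?k y \<and> ?l x = ?l y" if "x \<in> I" "y \<in> I" for x y
  proof -
    have *: "?k a = ?k b \<and> ?l a = ?l b" if "a \<in> I" "b \<in> I" "a \<le> b" for a b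
    proof -
      have "{a..b} \<subseteq> I" using ivl that unfolding is_interval_1 by (meson atLeastAtMost_iff subsetI)
      then show ?thesis
        using wronskian_const[OF S sol(1,3) _ that(3)] wronskian_const[OF S sol(2,1) _ that(3)] by blast
    qed
    show ?thesis
    proof (cases "x \<le> y")
      case True
      then show ?thesis by (rule *[OF that])
    next
      case False
      then have "y \<le> x" by simp
      from *[OF that(2,1) this] show ?thesis by (simp only: simp_thms)
    qed
  qed
  have rep: "u x = ?k x * u1 x + ?l x * u2 x" "z x = ?k x * z1 x + ?l x * z2 x" if "x \<in> I" for x
  proof -
    have "?k x * u1 x + ?l x * u2 x = u x * (u1 x * z2 x - z1 x * u2 x)" by (simp add: algebra_simps)
    then show "u x = ?k x * u1 x + ?l x * u2 x" using det[OF that] by simp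
    have "?k x * z1 x + ?l x * z2 x = z x * (u1 x * z2 x - z1 x * u2 x)" by (simp add: algebra_simps)
    then show "z x = ?k x * z1 x + ?l x * z2 x" using det[OF that] by simp
  qed
  show thesis
  proof (cases "I = {}")
    case False
    then obtain p where p: "p \<in> I" by blast
    show thesis
    proof (rule that[of "?k p" "?l p"])
      fix x assume x: "x \<in> I"
      show "u x = ?k p * u1 x + ?l p * u2 x" "z x = ?k p * z1 x + ?l p * z2 x"
        using rep[OF x] kl[OF x p] by simp_all
    qed
  next
    case True
    show thesis by (rule that[of 0 0]) (simp_all add: True)
  qed
qed

text \<open>The flux \<open>Re (u * cnj z)\<close> has derivative \<open>Re s\<close> times
  \<open>r |u|^2 + |z|^2 / r\<close>, which is at least twice the flux by the inequality of
  arithmetic and geometric means. For \<open>Re s \<le> 0\<close> this gives the sharp rate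
  \<open>2 * Re s\<close>, independent of \<open>r\<close> and of \<open>Im s\<close>.\<close>

lemma flux_antimono:
  assumes "finite S" "a \<le> b" and sol: "system_on {a..b} S r s u z"
    and r: "\<And>x. x \<in> {a<..<b} \<Longrightarrow> r x > 0" and s: "Re s \<le> 0"
  shows "exp (- 2 * Re s * b) * Re (u b * cnj (z b)) \<le> exp (- 2 * Re s * a) * Re (u a * cnj (z a))"
proof (rule antimono_finite_exceptions[OF assms(1,2)])
  show "continuous_on {a..b} (\<lambda>x. exp (- 2 * Re s * x) * Re (u x * cnj (z x)))"
    using sol unfolding system_on_def by (intro continuous_intros) auto
  fix x assume x: "x \<in> {a<..<b} - S"
  define \<rho> where "\<rho> = r x"
  have \<rho>: "\<rho> > 0" using r x by (auto simp: \<rho>_def)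
  have D: "(u has_vector_derivative s * z x / of_real \<rho>) (at x)"
      "(z has_vector_derivative s * of_real \<rho> * u x) (at x)"
    using sol x unfolding system_on_def \<rho>_def by auto
  have D1: "((\<lambda>x. Re (u x * cnj (z x))) has_vector_derivative
      Re (u x * cnj (s * of_real \<rho> * u x) + s * z x / of_real \<rho> * cnj (z x))) (at x)"
    by (intro bounded_linear.has_vector_derivative[OF bounded_linear_Re] has_vector_derivative_mult D
        bounded_linear.has_vector_derivative[OF bounded_linear_cnj])
  have E: "Re (u x * cnj (s * of_real \<rho> * u x) + s * z x / of_real \<rho> * cnj (z x))
      = Re s * (\<rho> * (norm (u x))\<^sup>2 + (norm (z x))\<^sup>2 / \<rho>)"
    unfolding cmod_power2 using \<rho> by (simp add: power2_eq_square field_simps)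
  have D2: "((\<lambda>x. exp (- 2 * Re s * x)) has_vector_derivative (- 2 * Re s) * exp (- 2 * Re s * x)) (at x)"
    unfolding has_real_derivative_iff_has_vector_derivative[symmetric]
    by (rule derivative_eq_intros refl | simp)+
  have "2 * Re (u x * cnj (z x)) \<le> \<rho> * (norm (u x))\<^sup>2 + (norm (z x))\<^sup>2 / \<rho>"
  proof -
    have "Re (u x * cnj (z x)) \<le> norm (u x) * norm (z x)"
      using complex_Re_le_cmod[of "u x * cnj (z x)"] by (simp add: norm_mult)
    moreover have "0 \<le> (\<rho> * norm (u x) - norm (z x))\<^sup>2 / \<rho>" using \<rho> by simp
    moreover have "(\<rho> * norm (u x) - norm (z x))\<^sup>2 / \<rho> =
        \<rho> * (norm (u x))\<^sup>2 + (norm (z x))\<^sup>2 / \<rho> - 2 * (norm (u x) * norm (z x))"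
      using \<rho> by (simp add: field_simps power2_eq_square)
    ultimately show ?thesis by linarith
  qed
  then have "Re s * (\<rho> * (norm (u x))\<^sup>2 + (norm (z x))\<^sup>2 / \<rho>) \<le> Re s * (2 * Re (u x * cnj (z x)))"
    using s by (intro mult_left_mono_neg)
  then have "Re s * (\<rho> * (norm (u x))\<^sup>2 + (norm (z x))\<^sup>2 / \<rho>) - 2 * Re s * Re (u x * cnj (z x)) \<le> 0"
    by (simp add: algebra_simps)
  then have "exp (- 2 * Re s * x) * (Re s * (\<rho> * (norm (u x))\<^sup>2 + (norm (z x))\<^sup>2 / \<rho>) -
      2 * Re s * Re (u x * cnj (z x))) \<le> 0" by (simp add: mult_le_0_iff)
  then show "((\<lambda>x. exp (- 2 * Re s * x) * Re (u x * cnj (z x))) has_vector_derivative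
      exp (- 2 * Re s * x) * (Re s * (\<rho> * (norm (u x))\<^sup>2 + (norm (z x))\<^sup>2 / \<rho>) -
      2 * Re s * Re (u x * cnj (z x)))) (at x) \<and> exp (- 2 * Re s * x) * (Re s * (\<rho> * (norm (u x))\<^sup>2 + (norm (z x))\<^sup>2 / \<rho>) -
      2 * Re s * Re (u x * cnj (z x))) \<le> 0"
    using has_vector_derivative_mult[OF D2 D1[unfolded E]] by (simp add: algebra_simps)
qed

section \<open>Energy estimates uniform in the imaginary part of \<open>s\<close>\<close>

definition sq_norm :: "(real \<Rightarrow> complex) \<Rightarrow> (real \<Rightarrow> complex) \<Rightarrow> real \<Rightarrow> real" where
  "sq_norm u z x = (norm (u x))\<^sup>2 + (norm (z x))\<^sup>2"

text \<open>The weight is a constant to be chosen, not the function \<open>r\<close>: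
  \<open>r\<close> may jump, and elsewhere its derivative exists only almost everywhere. When
  \<open>\<rho>\<close> is the impedance, the derivative becomes
  \<open>4 * Re s * Re (u * cnj z)\<close>, free of \<open>Im s\<close>.\<close>

definition energy :: "real \<Rightarrow> (real \<Rightarrow> complex) \<Rightarrow> (real \<Rightarrow> complex) \<Rightarrow> real \<Rightarrow> real" where
  "energy \<rho> u z x = \<rho> * (norm (u x))\<^sup>2 + (norm (z x))\<^sup>2 / \<rho>"

lemma energy_nonneg: "\<rho> > 0 \<Longrightarrow> 0 \<le> energy \<rho> u z x"
  by (simp add: energy_def)

text \<open>Both quotients of the two weights are at most
  \<open>1 + \<bar>\<rho>' - \<rho>\<bar> / m\<close>. In exponential form the factors of successive
  cells multiply to the exponential of a sum of increments, that is of a variation.\<close>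

lemma energy_change_weight:
  assumes "m > 0" "m \<le> \<rho>" "m \<le> \<rho>'"
  shows "energy \<rho>' u z x \<le> exp (\<bar>\<rho>' - \<rho>\<bar> / m) * energy \<rho> u z x"
proof -
  have pos: "\<rho> > 0" "\<rho>' > 0" using assms by auto
  define e where "e = 1 + \<bar>\<rho>' - \<rho>\<bar> / m"
  have "\<rho>' * m \<le> (m + \<bar>\<rho>' - \<rho>\<bar>) * \<rho>" "\<rho> * m \<le> (m + \<bar>\<rho>' - \<rho>\<bar>) * \<rho>'"
  proof -
    have *: "y * m \<le> (m + \<bar>y - x\<bar>) * x" if "m \<le> x" for x y :: real
    proof -
      have "(y - x) * m \<le> \<bar>y - x\<bar> * x" using that assms(1) by (intro mult_mono) auto
      then show ?thesis by (simp add: algebra_simps)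
    qed
    show "\<rho>' * m \<le> (m + \<bar>\<rho>' - \<rho>\<bar>) * \<rho>" "\<rho> * m \<le> (m + \<bar>\<rho>' - \<rho>\<bar>) * \<rho>'"
      using *[OF assms(2), of \<rho>'] *[OF assms(3), of \<rho>] by (simp_all add: abs_minus_commute)
  qed
  then have e: "\<rho>' \<le> e * \<rho>" "1 / \<rho>' \<le> e / \<rho>"
    using pos assms(1) by (simp_all add: e_def field_simps)
  have "energy \<rho>' u z x \<le> (e * \<rho>) * (norm (u x))\<^sup>2 + (e / \<rho>) * (norm (z x))\<^sup>2"
    unfolding energy_def using e(1) mult_right_mono[OF e(2), of "(norm (z x))\<^sup>2"]
    by (intro add_mono mult_right_mono) auto
  also have "\<dots> = e * energy \<rho> u z x" by (simp add: energy_def algebra_simps)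
  also have "\<dots> \<le> exp (\<bar>\<rho>' - \<rho>\<bar> / m) * energy \<rho> u z x"
    using exp_ge_add_one_self[of "\<bar>\<rho>' - \<rho>\<bar> / m"] energy_nonneg[OF pos(1)]
    by (intro mult_right_mono) (simp_all add: e_def)
  finally show ?thesis .
qed

text \<open>The rate \<open>k\<close> has two sources: \<open>2 * \<bar>Re s\<bar>\<close> belongs
  to a constant impedance, and \<open>2 * \<eta> * norm s / m\<close> is the error of freezing
  \<open>r\<close> at \<open>\<rho>\<close>, which vanishes as the cells shrink. Both directions are
  stated because the estimates will be run from either end.\<close>

lemma energy_frozen:
  assumes "finite S" "a \<le> b" and sol: "system_on {a..b} S r s u z"
    and m: "m > 0" "m \<le> \<rho>" "\<And>x. x \<in> {a<..<b} \<Longrightarrow> m \<le> r x"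
    and \<eta>: "\<And>x. x \<in> {a<..<b} \<Longrightarrow> \<bar>r x - \<rho>\<bar> \<le> \<eta>"
    and k: "k = 2 * \<bar>Re s\<bar> + 2 * \<eta> * norm s / m"
  shows "energy \<rho> u z b \<le> exp (k * (b - a)) * energy \<rho> u z a \<and>
         energy \<rho> u z a \<le> exp (k * (b - a)) * energy \<rho> u z b"
proof -
  have \<rho>: "\<rho> > 0" using m by auto
  define D where "D x = 2 * (\<rho> / r x * Re (s * cnj (u x) * z x) + r x / \<rho> * Re (s * u x * cnj (z x)))" for x
  have cont: "continuous_on {a..b} (energy \<rho> u z)"
    using sol \<rho> unfolding system_on_def energy_def by (intro continuous_intros) auto
  have E: "(energy \<rho> u z has_vector_derivative D x) (at x)" "\<bar>D x\<bar> \<le> k * energy \<rho> u z x"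
    if x: "x \<in> {a<..<b} - S" for x
  proof -
    have rx: "r x > 0" "m \<le> r x" using m(1) m(3)[of x] x by auto
    have D': "(u has_vector_derivative s * z x / of_real (r x)) (at x)"
      "(z has_vector_derivative s * of_real (r x) * u x) (at x)"
      using sol x unfolding system_on_def by auto
    have "energy \<rho> u z = (\<lambda>x. \<rho> * Re (u x * cnj (u x)) + 1 / \<rho> * Re (z x * cnj (z x)))"
      by (simp add: energy_def cmod_power2 fun_eq_iff) (simp add: power2_eq_square)
    moreover have "((\<lambda>x. \<rho> * Re (u x * cnj (u x)) + 1 / \<rho> * Re (z x * cnj (z x))) has_vector_derivative
      \<rho> * Re (u x * cnj (s * z x / of_real (r x)) + s * z x / of_real (r x) * cnj (u x)) +
      1 / \<rho> * Re (z x * cnj (s * of_real (r x) * u x) + s * of_real (r x) * u x * cnj (z x))) (at x)"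
      by (intro has_vector_derivative_add has_vector_derivative_mult_right
          bounded_linear.has_vector_derivative[OF bounded_linear_Re] has_vector_derivative_mult D'
          bounded_linear.has_vector_derivative[OF bounded_linear_cnj])
    moreover have "\<rho> * Re (u x * cnj (s * z x / of_real (r x)) + s * z x / of_real (r x) * cnj (u x)) +
      1 / \<rho> * Re (z x * cnj (s * of_real (r x) * u x) + s * of_real (r x) * u x * cnj (z x)) = D x"
      using \<rho> rx unfolding D_def by (simp add: field_simps)
    ultimately show "(energy \<rho> u z has_vector_derivative D x) (at x)" by simp
    define p q where "p = Re (s * cnj (u x) * z x)" and "q = Re (s * u x * cnj (z x))"
    define w where "w = norm (u x) * norm (z x)"
    have w0: "w \<ge> 0" by (simp add: w_def)
    have p: "\<bar>p\<bar> \<le> norm s * w" unfolding p_def w_def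
      using abs_Re_le_cmod[of "s * cnj (u x) * z x"] by (simp add: norm_mult mult.assoc)
    have q: "\<bar>q\<bar> \<le> norm s * w" unfolding q_def w_def
      using abs_Re_le_cmod[of "s * u x * cnj (z x)"] by (simp add: norm_mult mult.assoc)
    \<comment> \<open>Here \<open>Im s\<close> cancels. It survives only in the two correction
      terms, each of which carries a factor \<open>r x - \<rho>\<close> up to sign.\<close>
    have "p + q = 2 * (Re s * Re (u x * cnj (z x)))" by (simp add: p_def q_def algebra_simps)
    moreover have "\<bar>Re s * Re (u x * cnj (z x))\<bar> \<le> \<bar>Re s\<bar> * w"
      using abs_Re_le_cmod[of "u x * cnj (z x)"]
      by (simp add: abs_mult w_def norm_mult mult_left_mono)
    ultimately have pq: "\<bar>p + q\<bar> \<le> 2 * (\<bar>Re s\<bar> * w)" by linarith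
    have wE: "2 * w \<le> energy \<rho> u z x"
    proof -
      have "0 \<le> (\<rho> * norm (u x) - norm (z x))\<^sup>2 / \<rho>" using \<rho> by simp
      also have "\<dots> = energy \<rho> u z x - 2 * w"
        using \<rho> by (simp add: field_simps power2_eq_square energy_def w_def)
      finally show ?thesis by simp
    qed
    have \<eta>0: "\<eta> \<ge> 0" using \<eta>[of x] x by auto
    have e1: "\<bar>(\<rho> - r x) / r x * p\<bar> \<le> \<eta> / m * (norm s * w)"
      unfolding abs_mult abs_divide
      using \<eta>[of x] x rx m(1) p w0 \<eta>0 by (intro mult_mono frac_le) (auto simp: abs_minus_commute)
    have e2: "\<bar>(r x - \<rho>) / \<rho> * q\<bar> \<le> \<eta> / m * (norm s * w)"
      unfolding abs_mult abs_divide
      using \<eta>[of x] x \<rho> m q w0 \<eta>0 by (intro mult_mono frac_le) auto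
    have "D x = 2 * ((p + q) + (\<rho> - r x) / r x * p + (r x - \<rho>) / \<rho> * q)"
      using \<rho> rx unfolding D_def p_def[symmetric] q_def[symmetric] by (simp add: field_simps)
    moreover have "\<bar>2 * (a + b + c)\<bar> \<le> 2 * (\<bar>a\<bar> + \<bar>b\<bar> + \<bar>c\<bar>)" for a b c :: real by (smt (verit))
    ultimately have "\<bar>D x\<bar> \<le> 2 * (\<bar>p + q\<bar> + \<bar>(\<rho> - r x) / r x * p\<bar> + \<bar>(r x - \<rho>) / \<rho> * q\<bar>)"
      by metis
    also have "\<dots> \<le> 2 * (2 * (\<bar>Re s\<bar> * w) + \<eta> / m * (norm s * w) + \<eta> / m * (norm s * w))"
      using pq e1 e2 by (intro mult_left_mono add_mono) auto
    also have "\<dots> = k * (2 * w)" unfolding k by (simp add: algebra_simps)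
    also have "\<dots> \<le> k * energy \<rho> u z x"
      using wE k \<eta>0 m(1) by (intro mult_left_mono) auto
    finally show "\<bar>D x\<bar> \<le> k * energy \<rho> u z x" .
  qed
  have X: "((\<lambda>x. exp (c * x)) has_vector_derivative c * exp (c * x)) (at x)" for c x :: real
    unfolding has_real_derivative_iff_has_vector_derivative[symmetric]
    by (rule derivative_eq_intros refl | simp)+
  have "exp (- k * b) * energy \<rho> u z b \<le> exp (- k * a) * energy \<rho> u z a"
  proof (rule antimono_finite_exceptions[OF assms(1,2)])
    show "continuous_on {a..b} (\<lambda>x. exp (- k * x) * energy \<rho> u z x)"
      using cont by (intro continuous_intros) auto
    fix x assume x: "x \<in> {a<..<b} - S"
    have "exp (- k * x) * (D x - k * energy \<rho> u z x) \<le> 0" using E(2)[OF x] by (simp add: mult_le_0_iff)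
    then show "((\<lambda>x. exp (- k * x) * energy \<rho> u z x) has_vector_derivative exp (- k * x) * (D x - k * energy \<rho> u z x)) (at x)
      \<and> exp (- k * x) * (D x - k * energy \<rho> u z x) \<le> 0"
      using has_vector_derivative_mult[OF X[of "- k" x] E(1)[OF x]] by (simp add: algebra_simps)
  qed
  then have "exp (k * b) * (exp (- k * b) * energy \<rho> u z b) \<le> exp (k * b) * (exp (- k * a) * energy \<rho> u z a)"
    by (intro mult_left_mono) auto
  then have 1: "energy \<rho> u z b \<le> exp (k * (b - a)) * energy \<rho> u z a"
    by (simp add: mult.assoc[symmetric] exp_add[symmetric] algebra_simps)
  have "- (exp (k * b) * energy \<rho> u z b) \<le> - (exp (k * a) * energy \<rho> u z a)"
  proof (rule antimono_finite_exceptions[OF assms(1,2)])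
    show "continuous_on {a..b} (\<lambda>x. - (exp (k * x) * energy \<rho> u z x))"
      using cont by (intro continuous_intros) auto
    fix x assume x: "x \<in> {a<..<b} - S"
    have "- (exp (k * x) * (D x + k * energy \<rho> u z x)) \<le> 0" using E(2)[OF x] by (simp add: zero_le_mult_iff)
    then show "((\<lambda>x. - (exp (k * x) * energy \<rho> u z x)) has_vector_derivative - (exp (k * x) * (D x + k * energy \<rho> u z x))) (at x)
      \<and> - (exp (k * x) * (D x + k * energy \<rho> u z x)) \<le> 0"
      using has_vector_derivative_minus[OF has_vector_derivative_mult[OF X[of k x] E(1)[OF x]]] by (simp add: algebra_simps)
  qed
  then have "exp (- k * a) * (exp (k * a) * energy \<rho> u z a) \<le> exp (- k * a) * (exp (k * b) * energy \<rho> u z b)"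
    by (intro mult_left_mono) auto
  then have "energy \<rho> u z a \<le> exp (k * (b - a)) * energy \<rho> u z b"
    by (simp add: mult.assoc[symmetric] exp_add[symmetric] algebra_simps)
  with 1 show ?thesis by blast
qed

lemma energy_sq_norm:
  assumes "m > 0" "m \<le> \<rho>" "\<rho> \<le> K"
  shows "energy \<rho> u z x \<le> max K (1 / m) * sq_norm u z x"
    and "sq_norm u z x \<le> max K (1 / m) * energy \<rho> u z x"
proof -
  let ?\<mu> = "max K (1 / m)"
  have \<rho>: "\<rho> > 0" using assms by simp
  have i: "1 / \<rho> \<le> 1 / m" using assms by (simp add: frac_le)
  have "\<rho> * (norm (u x))\<^sup>2 \<le> ?\<mu> * (norm (u x))\<^sup>2" "1 / \<rho> * (norm (z x))\<^sup>2 \<le> ?\<mu> * (norm (z x))\<^sup>2"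
    using i assms(3) by (intro mult_right_mono; simp)+
  then show "energy \<rho> u z x \<le> ?\<mu> * sq_norm u z x"
    by (simp add: energy_def sq_norm_def algebra_simps)
  have "1 / \<rho> * (\<rho> * (norm (u x))\<^sup>2) \<le> ?\<mu> * (\<rho> * (norm (u x))\<^sup>2)"
    "\<rho> * (1 / \<rho> * (norm (z x))\<^sup>2) \<le> ?\<mu> * (1 / \<rho> * (norm (z x))\<^sup>2)"
    using i assms(3) \<rho> by (intro mult_right_mono; simp)+
  then show "sq_norm u z x \<le> ?\<mu> * energy \<rho> u z x"
    using \<rho> by (simp add: energy_def sq_norm_def algebra_simps)
qed

lemma abs_continuous_on_uniform:
  assumes "abs_continuous_on S f" "is_interval S" "\<epsilon> > 0"
  obtains \<delta> where "\<delta> > 0"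
    "\<And>x y. x \<in> S \<Longrightarrow> y \<in> S \<Longrightarrow> \<bar>x - y\<bar> < \<delta> \<Longrightarrow> dist (f x) (f y) < \<epsilon>"
proof -
  obtain \<delta> where \<delta>: "\<delta> > 0" and ac: "\<And>(n::nat) a b.
        (\<And>i. i < n \<Longrightarrow> a i \<le> b i \<and> {a i..b i} \<subseteq> S) \<Longrightarrow>
        disjoint_family_on (\<lambda>i. {a i<..<b i}) {..<n} \<Longrightarrow>
        (\<Sum>i<n. b i - a i) < \<delta> \<Longrightarrow> (\<Sum>i<n. dist (f (a i)) (f (b i))) < \<epsilon>"
    using abs_continuous_onD[OF assms(1,3)] by auto
  have *: "dist (f x) (f y) < \<epsilon>" if "x \<in> S" "y \<in> S" "x \<le> y" "y - x < \<delta>" for x y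
  proof -
    have "{x..y} \<subseteq> S" using assms(2) that unfolding is_interval_1 by (meson atLeastAtMost_iff subsetI)
    then show ?thesis using ac[of 1 "\<lambda>_. x" "\<lambda>_. y"] that by (simp add: disjoint_family_on_def)
  qed
  show thesis
  proof (rule that[OF \<delta>])
    fix x y assume xy: "x \<in> S" "y \<in> S" "\<bar>x - y\<bar> < \<delta>"
    show "dist (f x) (f y) < \<epsilon>"
    proof (cases "x \<le> y")
      case True
      with xy show ?thesis by (intro *) auto
    next
      case False
      with xy have "dist (f y) (f x) < \<epsilon>" by (intro *) auto
      then show ?thesis by (simp add: dist_commute)
    qed
  qed
qed

text \<open>Any \<open>k\<close> consecutive cells have total length below the
  \<open>\<delta>\<close> that belongs to \<open>\<epsilon> = 1\<close>, so they contribute at most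
  1, and there are \<open>N\<close> such blocks. As \<open>N\<close> depends neither on the end
  points nor on \<open>k\<close>, the mesh can be refined while the bound stays.\<close>

lemma abs_continuous_uniform_variation:
  fixes f :: "real \<Rightarrow> 'a::metric_space"
  assumes "abs_continuous_on {a<..<b} f" "a < b"
  obtains N :: nat where "N > 0"
    "\<And>x y k. a < x \<Longrightarrow> x \<le> y \<Longrightarrow> y < b \<Longrightarrow> k > 0 \<Longrightarrow>
      (\<Sum>j<N * k. dist (f (x + real j * ((y - x) / real (N * k)))) (f (x + real (Suc j) * ((y - x) / real (N * k))))) \<le> real N"
proof -
  obtain \<delta> where \<delta>: "\<delta> > 0" and ac: "\<And>(n::nat) l u.
        (\<And>i. i < n \<Longrightarrow> l i \<le> u i \<and> {l i..u i} \<subseteq> {a<..<b}) \<Longrightarrow>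
        disjoint_family_on (\<lambda>i. {l i<..<u i}) {..<n} \<Longrightarrow>
        (\<Sum>i<n. u i - l i) < \<delta> \<Longrightarrow> (\<Sum>i<n. dist (f (l i)) (f (u i))) < 1"
    using abs_continuous_onD[OF assms(1), of 1] by auto
  obtain N :: nat where N: "real N > (b - a) / \<delta>" using reals_Archimedean2 by blast
  have N0: "N > 0" using N assms(2) \<delta> by (cases "N = 0") (auto simp: divide_less_0_iff)
  show thesis
  proof (rule that[OF N0])
    fix x y :: real and k :: nat assume xy: "a < x" "x \<le> y" "y < b" and k: "k > 0"
    define h where "h = (y - x) / real (N * k)"
    have h0: "h \<ge> 0" using xy by (simp add: h_def)
    have hNk: "real (N * k) * h = y - x" using N0 k by (simp add: h_def)
    have "real k * h = (y - x) / N" using N0 k by (simp add: h_def)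
    also have "\<dots> < \<delta>" using xy N N0 \<delta> by (simp add: field_simps)
    finally have kh: "real k * h < \<delta>" .
    define g where "g j = dist (f (x + real j * h)) (f (x + real (Suc j) * h))" for j
    have block: "(\<Sum>j\<in>{i * k..<i * k + k}. g j) \<le> 1" if i: "i < N" for i
    proof -
      let ?l = "\<lambda>j. x + real (i * k + j) * h" and ?u = "\<lambda>j. x + real (Suc (i * k + j)) * h"
      have "(\<Sum>j\<in>{i * k..<i * k + k}. g j) = (\<Sum>j<k. g (i * k + j))"
        by (rule sum.reindex_bij_witness[of _ "\<lambda>j. i * k + j" "\<lambda>j. j - i * k"]) auto
      also have "\<dots> = (\<Sum>j<k. dist (f (?l j)) (f (?u j)))" by (simp add: g_def)
      also have "\<dots> < 1"
      proof (rule ac)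
        fix j assume j: "j < k"
        have "Suc (i * k + j) \<le> Suc i * k" using j by simp
        also have "\<dots> \<le> N * k" using i by (intro mult_right_mono) auto
        finally have "real (Suc (i * k + j)) \<le> real (N * k)" by (rule of_nat_mono)
        then have "real (Suc (i * k + j)) * h \<le> real (N * k) * h"
          using h0 by (rule mult_right_mono)
        then have "?u j \<le> y" using hNk by simp
        moreover have "?l j \<ge> x" using h0 by simp
        moreover have "?l j \<le> ?u j" using h0 by (simp add: algebra_simps)
        ultimately show "?l j \<le> ?u j \<and> {?l j..?u j} \<subseteq> {a<..<b}" using xy by auto
      next
        show "disjoint_family_on (\<lambda>j. {?l j<..<?u j}) {..<k}"
        proof (unfold disjoint_family_on_def, intro ballI impI)
          have *: "{?l p<..<?u p} \<inter> {?l q<..<?u q} = {}" if "p < q" for p q :: nat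
          proof -
            have "real (Suc (i * k + p)) * h \<le> real (i * k + q) * h"
              using that h0 by (intro mult_right_mono) auto
            then show ?thesis by auto
          qed
          fix p q :: nat assume "p \<noteq> q"
          then show "{?l p<..<?u p} \<inter> {?l q<..<?u q} = {}"
            using *[of p q] *[of q p] by (cases "p < q") (simp_all add: Int_commute)
        qed
        have "(\<Sum>j<k. ?u j - ?l j) = (\<Sum>j<k. h)" by (intro sum.cong) (auto simp: algebra_simps)
        then show "(\<Sum>j<k. ?u j - ?l j) < \<delta>" using kh by simp
      qed
      finally show ?thesis by simp
    qed
    have "(\<Sum>j<N * k. g j) = (\<Sum>i<N. \<Sum>j\<in>{i * k..<i * k + k}. g j)" by (rule sum.nat_group[symmetric])
    also have "\<dots> \<le> (\<Sum>i<N. 1)" by (intro sum_mono block) auto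
    finally show "(\<Sum>j<N * k. dist (f (x + real j * ((y - x) / real (N * k))))
        (f (x + real (Suc j) * ((y - x) / real (N * k))))) \<le> real N"
      by (simp add: g_def h_def)
  qed
qed

text \<open>On each cell of a fine partition \<open>r\<close> is frozen to its value at the left end point, which
  costs a factor tending to 1; passing to the next cell costs \<open>exp (\<bar>\<Delta> r\<bar> / m)\<close>, and the product of
  these is controlled by the variation of \<open>r\<close>.\<close>

lemma energy_partition:
  assumes fin: "finite S" and sol: "system_on {x..y} S r s u z" and n: "n > 0" and xy: "x \<le> y"
    and m: "m > 0" "\<And>t. t \<in> {x..y} \<Longrightarrow> m \<le> r t"
    and osc: "\<And>t t'. t \<in> {x..y} \<Longrightarrow> t' \<in> {x..y} \<Longrightarrow> \<bar>t - t'\<bar> \<le> (y - x) / real n \<Longrightarrow> \<bar>r t - r t'\<bar> \<le> \<eta>"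
    and var: "(\<Sum>j<n. \<bar>r (x + real j * ((y - x) / real n)) - r (x + real (Suc j) * ((y - x) / real n))\<bar>) \<le> V"
    and k: "k = 2 * \<bar>Re s\<bar> + 2 * \<eta> * norm s / m"
  shows "energy (r y) u z y \<le> exp (k * (y - x) + V / m) * energy (r x) u z x \<and>
         energy (r x) u z x \<le> exp (k * (y - x) + V / m) * energy (r y) u z y"
proof -
  define h where "h = (y - x) / real n"
  define p where "p j = x + real j * h" for j
  have h0: "h \<ge> 0" and hn: "real n * h = y - x" using xy n by (simp_all add: h_def)
  have \<eta>0: "\<eta> \<ge> 0" using osc[of x x] xy by simp
  define D where "D j = \<bar>r (p j) - r (p (Suc j))\<bar>" for j
  have p: "p j \<in> {x..y}" if "j \<le> n" for j
  proof -
    have "real j * h \<le> real n * h" using that h0 by (intro mult_right_mono) auto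
    then show ?thesis using hn h0 by (simp add: p_def)
  qed
  define G where "G j = energy (r (p j)) u z (p j)" for j
  have step: "G (Suc j) \<le> exp (k * h + D j / m) * G j \<and> G j \<le> exp (k * h + D j / m) * G (Suc j)"
    if j: "j < n" for j
  proof -
    have pj: "p j \<in> {x..y}" "p (Suc j) \<in> {x..y}" using p j by auto
    have le: "p j \<le> p (Suc j)" and df: "p (Suc j) - p j = h" using h0 by (auto simp: p_def algebra_simps)
    have fr: "energy (r (p j)) u z (p (Suc j)) \<le> exp (k * (p (Suc j) - p j)) * energy (r (p j)) u z (p j) \<and>
         energy (r (p j)) u z (p j) \<le> exp (k * (p (Suc j) - p j)) * energy (r (p j)) u z (p (Suc j))"
    proof (rule energy_frozen[OF fin le _ m(1) _ _ _ k])
      show "system_on {p j..p (Suc j)} S r s u z"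
        using pj by (intro system_on_subset[OF sol]) auto
      show "m \<le> r (p j)" by (intro m pj)
      fix t assume t: "t \<in> {p j<..<p (Suc j)}"
      then have "t \<in> {x..y}" using pj by auto
      then show "m \<le> r t" "\<bar>r t - r (p j)\<bar> \<le> \<eta>"
        using m(2) osc[of t "p j"] pj t df by (auto simp: h_def)
    qed
    have rr: "m \<le> r (p j)" "m \<le> r (p (Suc j))" using m(2) pj by auto
    have c1: "energy (r (p (Suc j))) u z (p (Suc j)) \<le> exp (D j / m) * energy (r (p j)) u z (p (Suc j))"
      using energy_change_weight[OF m(1) rr, of u z "p (Suc j)"] by (simp add: D_def abs_minus_commute)
    have c2: "energy (r (p j)) u z (p (Suc j)) \<le> exp (D j / m) * energy (r (p (Suc j))) u z (p (Suc j))"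
      using energy_change_weight[OF m(1) rr(2,1), of u z "p (Suc j)"] by (simp add: D_def)
    have "G (Suc j) \<le> exp (D j / m) * (exp (k * h) * G j)"
      using fr df by (simp add: G_def) (rule order.trans[OF c1], simp)
    moreover have "G j \<le> exp (k * h) * (exp (D j / m) * G (Suc j))"
      using fr df c2 unfolding G_def by (metis exp_ge_zero mult_left_mono order.trans)
    ultimately show ?thesis by (simp add: exp_add mult_ac)
  qed
  have *: "j \<le> n \<Longrightarrow> G j \<le> exp (k * (real j * h) + (\<Sum>i<j. D i) / m) * G 0 \<and>
      G 0 \<le> exp (k * (real j * h) + (\<Sum>i<j. D i) / m) * G j" for j
  proof (induction j)
    case (Suc j)
    then have j: "j < n" by simp
    let ?a = "exp (k * h + D j / m)" and ?b = "exp (k * (real j * h) + (\<Sum>i<j. D i) / m)"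
    have e: "exp (k * (real (Suc j) * h) + (\<Sum>i<Suc j. D i) / m) = ?a * ?b"
      by (simp add: exp_add[symmetric] algebra_simps add_divide_distrib)
    have "G (Suc j) \<le> ?a * G j" "G j \<le> ?a * G (Suc j)" using step[OF j] by auto
    moreover have "G j \<le> ?b * G 0" "G 0 \<le> ?b * G j" using Suc.IH j by auto
    ultimately have "G (Suc j) \<le> ?a * (?b * G 0)" "G 0 \<le> ?b * (?a * G (Suc j))"
      by (meson exp_ge_zero mult_left_mono order.trans)+
    then show ?case unfolding e by (simp add: mult_ac)
  qed auto
  have pn: "p 0 = x" "p n = y" using hn by (auto simp: p_def)
  have le: "exp (k * (real n * h) + (\<Sum>i<n. D i) / m) \<le> exp (k * (y - x) + V / m)"
    using var m(1) unfolding hn by (simp add: D_def p_def h_def divide_right_mono)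
  have "0 \<le> energy (r x) u z x" "0 \<le> energy (r y) u z y"
    using m(1) m(2)[of x] m(2)[of y] xy by (auto intro!: energy_nonneg)
  then show ?thesis
    using *[of n] le unfolding G_def pn by (meson le_refl mult_right_mono order.trans)
qed

text \<open>The order of quantifiers matters: \<open>C\<close> is chosen before \<open>s\<close>,
  and the rate is exactly that of a homogeneous medium. The unweighted norm is used because it is
  continuous across the jumps of \<open>r\<close>, so that estimates on adjacent intervals can be
  glued.\<close>

definition energy_estimate :: "real set \<Rightarrow> (real \<Rightarrow> real) \<Rightarrow> real set \<Rightarrow> real \<Rightarrow> bool" where
  "energy_estimate S r I C \<longleftrightarrow> C \<ge> 1 \<and> (\<forall>s u z. system_on I S r s u z \<longrightarrow> (\<forall>x\<in>I. \<forall>y\<in>I.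
     sq_norm u z y \<le> C * exp (2 * \<bar>Re s\<bar> * \<bar>y - x\<bar>) * sq_norm u z x))"

lemma sq_norm_nonneg: "0 \<le> sq_norm u z x"
  by (simp add: sq_norm_def)

lemma energy_estimate_open_piece:
  assumes fin: "finite S" and ab: "a < b" and ac: "abs_continuous_on {a<..<b} r"
    and m: "m > 0" "\<And>t. m \<le> r t" "\<And>t. r t \<le> K"
  obtains C where "energy_estimate S r {a<..<b} C"
proof -
  obtain N :: nat where N: "N > 0" and var: "\<And>x y k. a < x \<Longrightarrow> x \<le> y \<Longrightarrow> y < b \<Longrightarrow> k > 0 \<Longrightarrow>
      (\<Sum>j<N * k. dist (r (x + real j * ((y - x) / real (N * k)))) (r (x + real (Suc j) * ((y - x) / real (N * k))))) \<le> real N"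
    using abs_continuous_uniform_variation[OF ac ab] by blast
  have E: "energy (r y) u z y \<le> exp (2 * \<bar>Re s\<bar> * (y - x) + real N / m) * energy (r x) u z x \<and>
      energy (r x) u z x \<le> exp (2 * \<bar>Re s\<bar> * (y - x) + real N / m) * energy (r y) u z y"
    if sol: "system_on {a<..<b} S r s u z" and xy: "a < x" "x \<le> y" "y < b" for s u z x y
  proof -
    let ?e = "\<lambda>\<eta>. exp ((2 * \<bar>Re s\<bar> + 2 * \<eta> * norm s / m) * (y - x) + real N / m)"
    have *: "energy (r y) u z y \<le> ?e \<eta> * energy (r x) u z x \<and>
      energy (r x) u z x \<le> ?e \<eta> * energy (r y) u z y" if \<eta>: "\<eta> > 0" for \<eta>
    proof -
      obtain \<delta> where \<delta>: "\<delta> > 0"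
        "\<And>t t'. t \<in> {a<..<b} \<Longrightarrow> t' \<in> {a<..<b} \<Longrightarrow> \<bar>t - t'\<bar> < \<delta> \<Longrightarrow> dist (r t) (r t') < \<eta>"
        using abs_continuous_on_uniform[OF ac is_interval_oo \<eta>] by blast
      obtain k :: nat where k: "real k > (y - x) / \<delta>" using reals_Archimedean2 by blast
      have k0: "Suc k > 0" by simp
      have "(y - x) / real (N * Suc k) < \<delta>"
      proof -
        have "y - x < real k * \<delta>" using k \<delta>(1) by (simp add: field_simps)
        also have "\<dots> \<le> real (N * Suc k) * \<delta>"
        proof -
          have "k \<le> N * Suc k" using N by (cases N) auto
          then show ?thesis using \<delta>(1) by (intro mult_right_mono of_nat_mono) auto
        qed
        finally show ?thesis using N by (simp add: field_simps del: of_nat_Suc of_nat_mult)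
      qed
      note small = this
      show ?thesis
      proof (rule energy_partition[OF fin _ _ xy(2) m(1) _ _ _ refl])
        show "system_on {x..y} S r s u z" using xy by (intro system_on_subset[OF sol]) auto
        show "N * Suc k > 0" using N by simp
        show "m \<le> r t" for t by (rule m(2))
        show "\<bar>r t - r t'\<bar> \<le> \<eta>" if "t \<in> {x..y}" "t' \<in> {x..y}" "\<bar>t - t'\<bar> \<le> (y - x) / real (N * Suc k)" for t t'
          using \<delta>(2)[of t t'] that xy small by (simp add: dist_real_def)
        show "(\<Sum>j<N * Suc k. \<bar>r (x + real j * ((y - x) / real (N * Suc k))) -
          r (x + real (Suc j) * ((y - x) / real (N * Suc k)))\<bar>) \<le> real N"
          using var[OF xy k0] unfolding dist_real_def .
      qed
    qed
    \<comment> \<open>\<open>N\<close> was fixed before \<open>\<eta>\<close>, so refining the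
      partition costs nothing, and the limit removes the term with \<open>norm s\<close> from the
      exponent.\<close>
    have lim: "((\<lambda>\<eta>. ?e \<eta> * A) \<longlongrightarrow> ?e 0 * A) (at_right 0)" for A
      using m(1) by (intro tendsto_intros) auto
    have ev: "eventually (\<lambda>\<eta>::real. \<eta> > 0) (at_right 0)" by (rule eventually_at_right_less)
    have "energy (r y) u z y \<le> ?e 0 * energy (r x) u z x"
      using tendsto_lowerbound[OF lim eventually_mono[OF ev] trivial_limit_at_right_real] * by blast
    moreover have "energy (r x) u z x \<le> ?e 0 * energy (r y) u z y"
      using tendsto_lowerbound[OF lim eventually_mono[OF ev] trivial_limit_at_right_real] * by blast
    ultimately show ?thesis by simp
  qed
  define \<mu> where "\<mu> = max K (1 / m)"
  have \<mu>0: "\<mu> \<ge> 0" using m(1) by (simp add: \<mu>_def le_max_iff_disj)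
  \<comment> \<open>One factor \<open>\<mu>\<close> for each of the two passages between the
    weighted energy and \<open>sq_norm\<close>, and the exponential for the variation. The bound by
    1 from below is what joining estimates requires.\<close>
  define C where "C = max 1 (\<mu> * \<mu> * exp (real N / m))"
  have "sq_norm u z y \<le> C * exp (2 * \<bar>Re s\<bar> * \<bar>y - x\<bar>) * sq_norm u z x"
    if sol: "system_on {a<..<b} S r s u z" and x: "x \<in> {a<..<b}" and y: "y \<in> {a<..<b}" for s u z x y
  proof -
    have "energy (r y) u z y \<le> exp (2 * \<bar>Re s\<bar> * \<bar>y - x\<bar> + real N / m) * energy (r x) u z x"
    proof (cases "x \<le> y")
      case True
      with E[OF sol, of x y] x y show ?thesis by simp
    next
      case False
      with E[OF sol, of y x] x y show ?thesis by simp
    qed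
    then have "\<mu> * energy (r y) u z y \<le> \<mu> * (exp (2 * \<bar>Re s\<bar> * \<bar>y - x\<bar> + real N / m) * (\<mu> * sq_norm u z x))"
      using energy_sq_norm(1)[OF m(1) m(2)[of x] m(3), of u z x] \<mu>0
      by (intro mult_left_mono) (auto simp: \<mu>_def intro: order.trans[OF _ mult_left_mono])
    then have "sq_norm u z y \<le> \<mu> * (exp (2 * \<bar>Re s\<bar> * \<bar>y - x\<bar> + real N / m) * (\<mu> * sq_norm u z x))"
      using energy_sq_norm(2)[OF m(1) m(2)[of y] m(3), of u z y] by (simp add: \<mu>_def)
    also have "\<dots> = (\<mu> * \<mu> * exp (real N / m)) * (exp (2 * \<bar>Re s\<bar> * \<bar>y - x\<bar>) * sq_norm u z x)"
      by (simp add: exp_add mult_ac)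
    also have "\<dots> \<le> C * (exp (2 * \<bar>Re s\<bar> * \<bar>y - x\<bar>) * sq_norm u z x)"
      by (intro mult_right_mono) (auto simp: C_def sq_norm_nonneg)
    finally show ?thesis by (simp add: mult.assoc)
  qed
  then have "energy_estimate S r {a<..<b} C" by (auto simp: energy_estimate_def C_def)
  then show thesis by (rule that)
qed

text \<open>Nothing is known about \<open>r\<close> at the end points, which may be jumps. The
  solution however is continuous up to them, and the inequality is a closed condition on the pair of
  points.\<close>

lemma energy_estimate_closure:
  assumes ab: "a < b" and est: "energy_estimate S r {a<..<b} C"
  shows "energy_estimate S r {a..b} C"
  unfolding energy_estimate_def
proof (intro conjI allI impI ballI)
  show "1 \<le> C" using est by (simp add: energy_estimate_def)
  fix s u z x y
  assume sol: "system_on {a..b} S r s u z" and xy: "x \<in> {a..b}" "y \<in> {a..b}"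
  have sol': "system_on {a<..<b} S r s u z" by (rule system_on_subset[OF sol]) auto
  let ?F = "\<lambda>q. C * exp (2 * \<bar>Re s\<bar> * \<bar>snd q - fst q\<bar>) * sq_norm u z (fst q) - sq_norm u z (snd q)"
  have cl: "closure ({a<..<b} \<times> {a<..<b}) = {a..b} \<times> {a..b}" using ab by (simp add: closure_Times)
  have c: "continuous_on {a..b} (sq_norm u z)"
    using sol unfolding sq_norm_def system_on_def by (intro continuous_intros) auto
  have "continuous_on ({a..b} \<times> {a..b}) ?F"
    by (intro continuous_intros continuous_on_compose2[OF c]) auto
  then have cF: "continuous_on (closure ({a<..<b} \<times> {a<..<b})) ?F" unfolding cl .
  have "?F (x, y) \<ge> 0"
  proof (rule continuous_ge_on_closure[OF cF])
    show "(x, y) \<in> closure ({a<..<b} \<times> {a<..<b})" using xy unfolding cl by simp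
    fix q assume "q \<in> {a<..<b} \<times> {a<..<b}"
    then have "fst q \<in> {a<..<b}" "snd q \<in> {a<..<b}" by (auto simp: mem_Times_iff)
    then show "?F q \<ge> 0" using est sol' by (simp add: energy_estimate_def)
  qed
  then show "sq_norm u z y \<le> C * exp (2 * \<bar>Re s\<bar> * \<bar>y - x\<bar>) * sq_norm u z x" by simp
qed

text \<open>Through the common point \<open>b\<close> the distances add, so the exponentials
  multiply without loss. Constants at least 1 ensure that the product also covers two points on the
  same side.\<close>

lemma energy_estimate_join:
  assumes abc: "a < b" "b < c" and est: "energy_estimate S r {a..b} C" "energy_estimate S r {b..c} D"
  shows "energy_estimate S r {a..c} (C * D)"
  unfolding energy_estimate_def
proof (intro conjI allI impI ballI)
  have CD: "C \<ge> 1" "D \<ge> 1" using est by (auto simp: energy_estimate_def)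
  have le: "C \<le> C * D" "D \<le> C * D" "1 \<le> C * D"
    using CD mult_mono[of 1 C 1 D] by (simp_all)
  show "1 \<le> C * D" by (rule le)
  fix s u z x y
  assume sol: "system_on {a..c} S r s u z" and xy: "x \<in> {a..c}" "y \<in> {a..c}"
  have sols: "system_on {a..b} S r s u z" "system_on {b..c} S r s u z"
    using abc by (auto intro: system_on_subset[OF sol])
  let ?e = "\<lambda>x y. exp (2 * \<bar>Re s\<bar> * \<bar>y - x\<bar>)"
  have L: "sq_norm u z y \<le> C * ?e x y * sq_norm u z x" if "x \<in> {a..b}" "y \<in> {a..b}" for x y
    using est(1) sols(1) that by (auto simp: energy_estimate_def)
  have R: "sq_norm u z y \<le> D * ?e x y * sq_norm u z x" if "x \<in> {b..c}" "y \<in> {b..c}" for x y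
    using est(2) sols(2) that by (auto simp: energy_estimate_def)
  have up: "A * ?e x y * sq_norm u z x \<le> C * D * ?e x y * sq_norm u z x" if "A \<le> C * D" for A x y
    using that by (intro mult_right_mono) (auto simp: sq_norm_nonneg)
  consider "x \<le> b" "y \<le> b" | "x \<ge> b" "y \<ge> b" | "x \<le> b" "b \<le> y" | "y \<le> b" "b \<le> x" by linarith
  then show "sq_norm u z y \<le> C * D * ?e x y * sq_norm u z x"
  proof cases
    case 1
    then show ?thesis using L[of x y] up[OF le(1), where x=x and y=y] xy by simp
  next
    case 2
    then show ?thesis using R[of x y] up[OF le(2), where x=x and y=y] xy by simp
  next
    case 3
    have "sq_norm u z y \<le> D * ?e b y * sq_norm u z b" using R[of b y] 3 xy by simp
    also have "\<dots> \<le> D * ?e b y * (C * ?e x b * sq_norm u z x)"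
      using L[of x b] 3 xy CD abc by (intro mult_left_mono) auto
    also have "\<dots> = C * D * (?e b y * ?e x b) * sq_norm u z x" by (simp add: mult_ac)
    also have "?e b y * ?e x b = ?e x y" using 3 by (simp add: exp_add[symmetric] algebra_simps)
    finally show ?thesis .
  next
    case 4
    have "sq_norm u z y \<le> C * ?e b y * sq_norm u z b" using L[of b y] 4 xy by simp
    also have "\<dots> \<le> C * ?e b y * (D * ?e x b * sq_norm u z x)"
      using R[of x b] 4 xy CD abc by (intro mult_left_mono) auto
    also have "\<dots> = C * D * (?e b y * ?e x b) * sq_norm u z x" by (simp add: mult_ac)
    also have "?e b y * ?e x b = ?e x y" using 4 by (simp add: exp_add[symmetric] algebra_simps)
    finally show ?thesis .
  qed
qed

lemma energy_estimate_partition: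
  assumes part: "interval_partition x0 x1 n p" and x01: "x0 < x1" and fin: "finite S"
    and ac: "\<And>i. i < n \<Longrightarrow> abs_continuous_on {p i<..<p (Suc i)} r"
    and m: "m > 0" "\<And>t. m \<le> r t" "\<And>t. r t \<le> K"
  obtains C where "energy_estimate S r {x0..x1} C"
proof -
  have p: "p 0 = x0" "p n = x1" "\<And>i. i < n \<Longrightarrow> p i < p (Suc i)"
    using part by (auto simp: interval_partition_def)
  have piece: "\<exists>C. energy_estimate S r {p i..p (Suc i)} C" if i: "i < n" for i
  proof -
    obtain C where "energy_estimate S r {p i<..<p (Suc i)} C"
      using energy_estimate_open_piece[OF fin p(3)[OF i] ac[OF i] m] .
    from energy_estimate_closure[OF p(3)[OF i] this] show ?thesis ..
  qed
  \<comment> \<open>The induction starts with one full piece, as joining needs a left interval of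
    positive length.\<close>
  have "Suc j \<le> n \<Longrightarrow> p 0 < p (Suc j) \<and> (\<exists>C. energy_estimate S r {p 0..p (Suc j)} C)" for j
  proof (induction j)
    case 0
    then show ?case using piece[of 0] p(3)[of 0] by simp
  next
    case (Suc j)
    then obtain C D where *: "p 0 < p (Suc j)" "p (Suc j) < p (Suc (Suc j))"
      "energy_estimate S r {p 0..p (Suc j)} C" "energy_estimate S r {p (Suc j)..p (Suc (Suc j))} D"
      using piece[of "Suc j"] p(3)[of "Suc j"] by auto
    from energy_estimate_join[OF *] *(1,2) show ?case by auto
  qed
  note this[of "n - 1"]
  moreover have "n \<noteq> 0" using p(1,2) x01 by (intro notI) simp
  ultimately have "\<exists>C. energy_estimate S r {p 0..p (Suc (n - 1))} C" by simp
  then show thesis using p(1,2) \<open>n \<noteq> 0\<close> that by auto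
qed

subsection \<open>Uniqueness of the medium\<close>

text \<open>The fundamental matrix of the system; for \<open>r = 1\<close> the columns \<open>(ch_u, sh_z)\<close> and
  \<open>(sh_u, ch_z)\<close> consist of hyperbolic cosines and sines of \<open>s (x - c)\<close>.\<close>

definition ch_u :: "(real \<Rightarrow> real) \<Rightarrow> real \<Rightarrow> complex \<Rightarrow> real \<Rightarrow> complex" where
  "ch_u r c s = parity_series True r (\<lambda>x. 1 / r x) c s"
definition sh_z :: "(real \<Rightarrow> real) \<Rightarrow> real \<Rightarrow> complex \<Rightarrow> real \<Rightarrow> complex" where
  "sh_z r c s = parity_series False r (\<lambda>x. 1 / r x) c s"
definition sh_u :: "(real \<Rightarrow> real) \<Rightarrow> real \<Rightarrow> complex \<Rightarrow> real \<Rightarrow> complex" where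
  "sh_u r c s = parity_series False (\<lambda>x. 1 / r x) r c s"
definition ch_z :: "(real \<Rightarrow> real) \<Rightarrow> real \<Rightarrow> complex \<Rightarrow> real \<Rightarrow> complex" where
  "ch_z r c s = parity_series True (\<lambda>x. 1 / r x) r c s"

text \<open>Twice the right and left going amplitudes at \<open>c\<close> of the solution which at \<open>d\<close> equals
  \<open>(1, \<kappa>)\<close>, i.e. is purely right going in a medium of impedance \<open>\<kappa>\<close>.\<close>

definition amp_right :: "(real \<Rightarrow> real) \<Rightarrow> real \<Rightarrow> real \<Rightarrow> real \<Rightarrow> complex \<Rightarrow> complex" where
  "amp_right r c d \<kappa> s = of_real \<kappa> * ch_u r c s d + ch_z r c s d - sh_z r c s d - of_real \<kappa> * sh_u r c s d"
definition amp_left :: "(real \<Rightarrow> real) \<Rightarrow> real \<Rightarrow> real \<Rightarrow> real \<Rightarrow> complex \<Rightarrow> complex" where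
  "amp_left r c d \<kappa> s = sh_z r c s d + ch_z r c s d - of_real \<kappa> * (ch_u r c s d + sh_u r c s d)"
definition reflection :: "(real \<Rightarrow> real) \<Rightarrow> real \<Rightarrow> real \<Rightarrow> real \<Rightarrow> complex \<Rightarrow> complex" where
  "reflection r c d \<kappa> s = amp_left r c d \<kappa> s / amp_right r c d \<kappa> s"

text \<open>Absolute continuity of the impedance is absorbed into \<open>est\<close>, so the complex
  analysis does not return to it. The parameter \<open>\<kappa>\<close> is the impedance attached
  beyond \<open>d\<close>; its relation to the medium is fixed later.\<close>

locale medium =
  fixes c d :: real and r :: "real \<Rightarrow> real" and S :: "real set" and m K \<kappa> C :: real
  assumes cd: "c < d" and finS: "finite S"
    and m: "m > 0" "\<And>x. m \<le> r x" "\<And>x. r x \<le> K"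
    and cont: "\<And>x. x \<notin> S \<Longrightarrow> isCont r x"
    and \<kappa>: "\<kappa> > 0"
    and est: "energy_estimate S r {c..d} C"
begin

lemma sq_norm_le:
  assumes "system_on {c..d} S r s u z" "x \<in> {c..d}" "y \<in> {c..d}"
  shows "sq_norm u z y \<le> C * exp (2 * \<bar>Re s\<bar> * \<bar>y - x\<bar>) * sq_norm u z x"
  using est assms unfolding energy_estimate_def by blast

lemma r_pos: "r x > 0" using m(1,2) less_le_trans by blast

lemma inverse_bounds: "\<bar>r x\<bar> \<le> max K (1 / m)" "\<bar>1 / r x\<bar> \<le> max K (1 / m)"
  using r_pos[of x] m(2)[of x] m(3)[of x] m(1) by (auto simp: le_max_iff_disj frac_le)

text \<open>Exchanging the two weights exchanges the roles of \<open>u\<close> and \<open>z\<close>: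
  \<open>A\<close> yields the column starting at \<open>(1, 0)\<close> and \<open>B\<close> the one
  starting at \<open>(0, 1)\<close>.\<close>

sublocale A: weights r "\<lambda>x. 1 / r x" S "max K (1 / m)" c d
  using cd finS inverse_bounds cont r_pos
  by unfold_locales (auto intro!: continuous_intros simp: less_imp_neq[THEN not_sym])

sublocale B: weights "\<lambda>x. 1 / r x" r S "max K (1 / m)" c d
  using cd finS inverse_bounds cont r_pos
  by unfold_locales (auto intro!: continuous_intros simp: less_imp_neq[THEN not_sym])

lemma system_on_columns:
  "system_on {c..d} S r s (ch_u r c s) (sh_z r c s)"
  "system_on {c..d} S r s (sh_u r c s) (ch_z r c s)"
proof -
  show "system_on {c..d} S r s (ch_u r c s) (sh_z r c s)"
    unfolding system_on_def ch_u_def sh_z_def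
    using A.parity_series_continuous A.parity_series_deriv[of _ True s] A.parity_series_deriv[of _ False s]
    by (simp add: algebra_simps)
  show "system_on {c..d} S r s (sh_u r c s) (ch_z r c s)"
    unfolding system_on_def sh_u_def ch_z_def
    using B.parity_series_continuous B.parity_series_deriv[of _ True s] B.parity_series_deriv[of _ False s]
    by (simp add: algebra_simps)
qed

lemma columns_start:
  "ch_u r c s c = 1" "sh_z r c s c = 0" "sh_u r c s c = 0" "ch_z r c s c = 1"
  by (simp_all add: ch_u_def sh_z_def sh_u_def ch_z_def A.parity_series_start B.parity_series_start)

lemma columns_0:
  "ch_u r c 0 x = 1" "sh_z r c 0 x = 0" "sh_u r c 0 x = 0" "ch_z r c 0 x = 1"
  by (simp_all add: ch_u_def sh_z_def sh_u_def ch_z_def A.parity_series_0 B.parity_series_0)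

lemma columns_minus:
  assumes "x \<in> {c..d}"
  shows "ch_u r c (- s) x = ch_u r c s x" "sh_z r c (- s) x = - sh_z r c s x"
    "sh_u r c (- s) x = - sh_u r c s x" "ch_z r c (- s) x = ch_z r c s x"
  using A.parity_series_minus[OF assms] B.parity_series_minus[OF assms]
  by (simp_all add: ch_u_def sh_z_def sh_u_def ch_z_def)

lemma columns_holomorphic:
  assumes "x \<in> {c..d}"
  shows "(\<lambda>s. ch_u r c s x) holomorphic_on X" "(\<lambda>s. sh_z r c s x) holomorphic_on X"
    "(\<lambda>s. sh_u r c s x) holomorphic_on X" "(\<lambda>s. ch_z r c s x) holomorphic_on X"
  unfolding ch_u_def sh_z_def sh_u_def ch_z_def
  by (rule holomorphic_on_subset[OF A.parity_series_holomorphic(1)[OF assms] subset_UNIV]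
      holomorphic_on_subset[OF B.parity_series_holomorphic(1)[OF assms] subset_UNIV])+

lemma sh_z_deriv_0:
  assumes "x \<in> {c..d}"
  shows "((\<lambda>s. sh_z r c s x) has_field_derivative of_real (integral {c..x} r)) (at 0)"
  using A.parity_series_holomorphic(2)[OF assms, of False] by (simp add: sh_z_def)

lemma columns_det:
  assumes "x \<in> {c..d}"
  shows "ch_u r c s x * ch_z r c s x - sh_z r c s x * sh_u r c s x = 1"
proof -
  have "{c..x} \<subseteq> {c..d}" "c \<le> x" using assms by auto
  from wronskian_const[OF finS system_on_columns this, of s] show ?thesis by (simp add: columns_start)
qed

lemma amp_holomorphic:
  "amp_right r c d \<kappa> holomorphic_on X" "amp_left r c d \<kappa> holomorphic_on X"
  using cd unfolding amp_right_def[abs_def] amp_left_def[abs_def]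
  by (intro holomorphic_intros columns_holomorphic; simp)+

text \<open>The coefficients are the inverse of the fundamental matrix at \<open>d\<close>, applied
  to \<open>(1, \<kappa>)\<close>. The determinant is 1, so the inverse is the adjugate and no
  division spoils holomorphy in \<open>s\<close>.\<close>

definition term_u :: "complex \<Rightarrow> real \<Rightarrow> complex" where
  "term_u s x = (ch_z r c s d - of_real \<kappa> * sh_u r c s d) * ch_u r c s x +
     (of_real \<kappa> * ch_u r c s d - sh_z r c s d) * sh_u r c s x"
definition term_z :: "complex \<Rightarrow> real \<Rightarrow> complex" where
  "term_z s x = (ch_z r c s d - of_real \<kappa> * sh_u r c s d) * sh_z r c s x +
     (of_real \<kappa> * ch_u r c s d - sh_z r c s d) * ch_z r c s x"

lemma system_on_term: "system_on {c..d} S r s (term_u s) (term_z s)"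
  unfolding term_u_def[abs_def] term_z_def[abs_def]
  by (intro system_on_combine system_on_columns)

lemma term_end: "term_u s d = 1" "term_z s d = of_real \<kappa>"
proof -
  have d: "ch_u r c s d * ch_z r c s d - sh_z r c s d * sh_u r c s d = 1"
    using cd by (intro columns_det) auto
  have "term_u s d = ch_u r c s d * ch_z r c s d - sh_z r c s d * sh_u r c s d"
    "term_z s d = of_real \<kappa> * (ch_u r c s d * ch_z r c s d - sh_z r c s d * sh_u r c s d)"
    by (simp_all add: term_u_def term_z_def algebra_simps)
  then show "term_u s d = 1" "term_z s d = of_real \<kappa>" unfolding d by simp_all
qed

lemma amp_term:
  "amp_right r c d \<kappa> s = term_u s c + term_z s c" "amp_left r c d \<kappa> s = term_u s c - term_z s c"
  by (simp_all add: amp_right_def amp_left_def term_u_def term_z_def columns_start algebra_simps)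

text \<open>By polarization the difference of the squared amplitudes is four times the flux at
  \<open>c\<close>, and this dominates the flux \<open>\<kappa>\<close> at \<open>d\<close>, carried
  back at the rate \<open>2 * Re s\<close>.\<close>

lemma amp_flux:
  assumes "Re s \<le> 0"
  shows "4 * \<kappa> * exp (2 * Re s * (c - d)) \<le> (norm (amp_right r c d \<kappa> s))\<^sup>2 - (norm (amp_left r c d \<kappa> s))\<^sup>2"
proof -
  have "exp (- 2 * Re s * d) * Re (term_u s d * cnj (term_z s d)) \<le>
      exp (- 2 * Re s * c) * Re (term_u s c * cnj (term_z s c))"
    using flux_antimono[OF finS _ system_on_term _ assms] cd r_pos by simp
  then have "exp (2 * Re s * c) * (exp (- 2 * Re s * d) * \<kappa>) \<le>
      exp (2 * Re s * c) * (exp (- 2 * Re s * c) * Re (term_u s c * cnj (term_z s c)))"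
    by (intro mult_left_mono) (auto simp: term_end)
  moreover have "exp p * (exp q * t) = exp (p + q) * t" for p q t :: real by (simp add: exp_add)
  ultimately have le: "exp (2 * Re s * (c - d)) * \<kappa> \<le> Re (term_u s c * cnj (term_z s c))"
    by (simp add: right_diff_distrib del: times_complex.sel)
  have "(norm (a + b))\<^sup>2 - (norm (a - b))\<^sup>2 = 4 * Re (a * cnj b)" for a b :: complex
    by (simp only: cmod_power2) (simp add: power2_eq_square algebra_simps)
  then show ?thesis
    unfolding amp_term using mult_left_mono[OF le, of 4] by (simp only: mult_ac)
qed

text \<open>The exponential size matters besides the absence of zeros: dividing the solution
  normalized at \<open>d\<close> by this amplitude is what makes it decay away from
  \<open>c\<close>.\<close>

lemma amp_right_lower:
  assumes "Re s \<le> 0"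
  shows "4 * \<kappa> * exp (2 * Re s * (c - d)) \<le> (norm (amp_right r c d \<kappa> s))\<^sup>2"
    and "amp_right r c d \<kappa> s \<noteq> 0"
proof -
  have "0 \<le> (norm (amp_left r c d \<kappa> s))\<^sup>2" by simp
  then show *: "4 * \<kappa> * exp (2 * Re s * (c - d)) \<le> (norm (amp_right r c d \<kappa> s))\<^sup>2"
    using amp_flux[OF assms] by linarith
  show "amp_right r c d \<kappa> s \<noteq> 0"
  proof
    assume "amp_right r c d \<kappa> s = 0"
    then have "4 * \<kappa> * exp (2 * Re s * (c - d)) \<le> 0" using * by simp
    then show False using \<kappa> by (simp add: mult_le_0_iff)
  qed
qed

lemma norm_refl_le_1:
  assumes "Re s \<le> 0"
  shows "norm (reflection r c d \<kappa> s) \<le> 1"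
proof -
  have "0 \<le> 4 * \<kappa> * exp (2 * Re s * (c - d))" using \<kappa> by simp
  then have "(norm (amp_left r c d \<kappa> s))\<^sup>2 \<le> (norm (amp_right r c d \<kappa> s))\<^sup>2"
    using amp_flux[OF assms] by linarith
  then have "norm (amp_left r c d \<kappa> s) \<le> norm (amp_right r c d \<kappa> s)" by (rule power2_le_imp_le) simp
  then show ?thesis using amp_right_lower(2)[OF assms] by (simp add: reflection_def norm_divide divide_le_eq)
qed

text \<open>The pair \<open>grow\<close> starts at \<open>(1, -1)\<close>, a wave purely left going
  at \<open>c\<close>. The pair \<open>decay\<close> starts at \<open>(1 + g, 1 - g)\<close>, a unit
  right going wave together with its reflection \<open>g\<close>. At \<open>c\<close> these data see
  the medium only through \<open>g\<close>.\<close>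

definition grow_u :: "complex \<Rightarrow> real \<Rightarrow> complex" where
  "grow_u s x = ch_u r c s x - sh_u r c s x"
definition grow_z :: "complex \<Rightarrow> real \<Rightarrow> complex" where
  "grow_z s x = sh_z r c s x - ch_z r c s x"
definition decay_u :: "complex \<Rightarrow> real \<Rightarrow> complex" where
  "decay_u s x = (1 + reflection r c d \<kappa> s) * ch_u r c s x + (1 - reflection r c d \<kappa> s) * sh_u r c s x"
definition decay_z :: "complex \<Rightarrow> real \<Rightarrow> complex" where
  "decay_z s x = (1 + reflection r c d \<kappa> s) * sh_z r c s x + (1 - reflection r c d \<kappa> s) * ch_z r c s x"

lemma grow_bound:
  assumes s: "Re s \<le> 0" and x: "x \<in> {c..d}"
  shows "sq_norm (grow_u s) (grow_z s) x \<le> 2 * C * exp (- 2 * Re s * (x - c))"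
proof -
  have "system_on {c..d} S r s (grow_u s) (grow_z s)"
    using system_on_combine[OF system_on_columns, of s 1 "- 1"]
    by (simp add: grow_u_def[abs_def] grow_z_def[abs_def])
  then have "sq_norm (grow_u s) (grow_z s) x \<le> C * exp (2 * \<bar>Re s\<bar> * \<bar>x - c\<bar>) * sq_norm (grow_u s) (grow_z s) c"
    by (rule sq_norm_le) (use x cd in auto)
  also have "sq_norm (grow_u s) (grow_z s) c = 2"
    by (simp add: sq_norm_def grow_u_def grow_z_def columns_start)
  also have "2 * \<bar>Re s\<bar> * \<bar>x - c\<bar> = - 2 * Re s * (x - c)" using s x by simp
  finally show ?thesis by (simp add: mult_ac)
qed

text \<open>The energy estimate started at \<open>c\<close> would only permit growth. Instead the
  solution is a multiple of \<open>term\<close>, estimated backwards from \<open>d\<close>, and the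
  factor is controlled by the lower bound on \<open>amp_right\<close>; the quotient of the two
  exponentials is the decay. The factor \<open>1 + \<kappa>\<^sup>2\<close> is the squared norm of
  \<open>(1, \<kappa>)\<close>.\<close>

lemma decay_bound:
  assumes s: "Re s \<le> 0" and x: "x \<in> {c..d}"
  shows "sq_norm (decay_u s) (decay_z s) x \<le> C * (1 + \<kappa>\<^sup>2) / \<kappa> * exp (2 * Re s * (x - c))"
proof -
  let ?A = "amp_right r c d \<kappa> s"
  have A: "?A \<noteq> 0" "4 * \<kappa> * exp (2 * Re s * (c - d)) \<le> (norm ?A)\<^sup>2" using amp_right_lower[OF s] by auto
  have "1 + reflection r c d \<kappa> s = 2 / ?A * (ch_z r c s d - of_real \<kappa> * sh_u r c s d)"
    "1 - reflection r c d \<kappa> s = 2 / ?A * (of_real \<kappa> * ch_u r c s d - sh_z r c s d)"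
    using A(1) by (simp_all add: reflection_def field_simps) (simp_all add: amp_right_def amp_left_def algebra_simps)
  then have "decay_u s x = 2 / ?A * term_u s x" "decay_z s x = 2 / ?A * term_z s x"
    by (simp_all only: decay_u_def decay_z_def term_u_def term_z_def) (simp_all only: algebra_simps)
  then have "sq_norm (decay_u s) (decay_z s) x = 4 / (norm ?A)\<^sup>2 * sq_norm (term_u s) (term_z s) x"
    by (simp add: sq_norm_def norm_mult norm_divide power_mult_distrib power_divide algebra_simps)
  also have "\<dots> \<le> 4 / (4 * \<kappa> * exp (2 * Re s * (c - d))) * (C * exp (2 * Re s * (x - d)) * (1 + \<kappa>\<^sup>2))"
  proof (rule mult_mono)
    show "4 / (norm ?A)\<^sup>2 \<le> 4 / (4 * \<kappa> * exp (2 * Re s * (c - d)))"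
      using A \<kappa> by (intro divide_left_mono) auto
    have "sq_norm (term_u s) (term_z s) x \<le> C * exp (2 * \<bar>Re s\<bar> * \<bar>x - d\<bar>) * sq_norm (term_u s) (term_z s) d"
      by (rule sq_norm_le[OF system_on_term]) (use x cd in auto)
    also have "sq_norm (term_u s) (term_z s) d = 1 + \<kappa>\<^sup>2"
      by (simp add: sq_norm_def term_end)
    also have "2 * \<bar>Re s\<bar> * \<bar>x - d\<bar> = 2 * Re s * (x - d)" using s x by (simp add: algebra_simps)
    finally show "sq_norm (term_u s) (term_z s) x \<le> C * exp (2 * Re s * (x - d)) * (1 + \<kappa>\<^sup>2)" .
  qed (use \<kappa> sq_norm_nonneg in auto)
  also have "\<dots> = C * (1 + \<kappa>\<^sup>2) / \<kappa> * (exp (2 * Re s * (x - d)) / exp (2 * Re s * (c - d)))"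
    using \<kappa> by (simp add: field_simps)
  also have "exp (2 * Re s * (x - d)) / exp (2 * Re s * (c - d)) = exp (2 * Re s * (x - c))"
    by (simp add: exp_diff[symmetric] algebra_simps)
  finally show ?thesis .
qed

end

section \<open>Comparison of two media with equal reflection coefficients\<close>

locale two_media = M: medium c d r S m K \<kappa> C + N: medium c d r' S' m' K' \<kappa>' C'
  for c d r S m K \<kappa> C r' S' m' K' \<kappa>' C' +
  assumes refl_eq: "\<And>\<omega>::real. reflection r c d \<kappa> (\<i> * of_real \<omega>) = reflection r' c d \<kappa>' (\<i> * of_real \<omega>)"
begin

text \<open>Cross multiplication turns the difference of the quotients into an entire function, so
  the identity theorem applies on the whole plane whatever the zeros of the denominators in
  \<open>Re s > 0\<close>. Division is undone only where both denominators are nonzero.\<close>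

lemma refl_eq_half_plane:
  assumes "Re s \<le> 0"
  shows "reflection r c d \<kappa> s = reflection r' c d \<kappa>' s"
proof -
  let ?F = "\<lambda>s. amp_left r c d \<kappa> s * amp_right r' c d \<kappa>' s - amp_left r' c d \<kappa>' s * amp_right r c d \<kappa> s"
  have "?F s = 0"
  proof (rule analytic_continuation[of ?F UNIV "range (\<lambda>\<omega>. \<i> * complex_of_real \<omega>)" 0])
    show "?F holomorphic_on UNIV"
      by (intro holomorphic_intros M.amp_holomorphic N.amp_holomorphic)
    show "0 islimpt range (\<lambda>\<omega>. \<i> * complex_of_real \<omega>)"
      unfolding islimpt_approachable
    proof (intro allI impI)
      fix e :: real assume "e > 0"
      then show "\<exists>x'\<in>range (\<lambda>\<omega>. \<i> * complex_of_real \<omega>). x' \<noteq> 0 \<and> dist x' 0 < e"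
        by (intro bexI[of _ "\<i> * complex_of_real (e / 2)"] rangeI) (auto simp: norm_mult)
    qed
    fix z assume "z \<in> range (\<lambda>\<omega>. \<i> * complex_of_real \<omega>)"
    then obtain \<omega> where z: "z = \<i> * complex_of_real \<omega>" by auto
    have "Re z \<le> 0" by (simp add: z)
    then show "?F z = 0"
      using refl_eq[of \<omega>] M.amp_right_lower(2)[of z] N.amp_right_lower(2)[of z]
      by (simp add: reflection_def z[symmetric] field_simps)
  qed auto
  then show ?thesis
    using M.amp_right_lower(2)[OF assms] N.amp_right_lower(2)[OF assms]
    by (simp add: reflection_def field_simps)
qed

text \<open>The second row of the product of one fundamental matrix with the inverse of the other. It is
  entire, and bounded on the left half plane as in each term a growing solution meets a decaying one;
  by parity it is bounded on the whole plane.\<close>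

lemma transition_const:
  assumes x: "x \<in> {c..d}"
  shows "sh_z r c s x * ch_z r' c s x - ch_z r c s x * sh_z r' c s x = 0"
    and "ch_z r c s x * ch_u r' c s x - sh_z r c s x * sh_u r' c s x = 1"
proof -
  define F where "F s = sh_z r c s x * ch_z r' c s x - ch_z r c s x * sh_z r' c s x" for s
  define G where "G s = ch_z r c s x * ch_u r' c s x - sh_z r c s x * sh_u r' c s x" for s
  have hol: "F holomorphic_on UNIV" "G holomorphic_on UNIV"
    unfolding F_def G_def using x
    by (intro holomorphic_intros M.columns_holomorphic N.columns_holomorphic; simp)+
  have par: "F (- s) = - F s" "G (- s) = G s" for s
    by (simp_all add: F_def G_def M.columns_minus[OF x] N.columns_minus[OF x])
  \<comment> \<open>Each summand pairs the constant \<open>2 * C\<close> of a growing solution in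
    one medium with the decay constant of the other medium.\<close>
  define b where "b = sqrt (2 * C * (C' * (1 + \<kappa>'\<^sup>2) / \<kappa>')) + sqrt (2 * C' * (C * (1 + \<kappa>\<^sup>2) / \<kappa>))"
  have half: "norm (F s) \<le> b \<and> norm (G s) \<le> b" if s: "Re s \<le> 0" for s
  proof -
    have prod: "norm (p * q) \<le> sqrt (P * Q)"
      if "(norm p)\<^sup>2 \<le> P * exp (- 2 * Re s * (x - c))" "(norm q)\<^sup>2 \<le> Q * exp (2 * Re s * (x - c))"
      for p q :: complex and P Q
    proof (rule real_le_rsqrt)
      have "(norm (p * q))\<^sup>2 = (norm p)\<^sup>2 * (norm q)\<^sup>2" by (simp add: norm_mult power_mult_distrib)
      also have "\<dots> \<le> (P * exp (- 2 * Re s * (x - c))) * (Q * exp (2 * Re s * (x - c)))"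
        using that by (intro mult_mono) (auto intro: order.trans[OF zero_le_power2])
      also have "\<dots> = P * Q * (exp (- 2 * Re s * (x - c)) * exp (2 * Re s * (x - c)))" by simp
      also have "\<dots> = P * Q" by (simp add: exp_add[symmetric])
      finally show "(norm (p * q))\<^sup>2 \<le> P * Q" .
    qed
    have sq: "(norm (u x))\<^sup>2 \<le> sq_norm u z x" "(norm (z x))\<^sup>2 \<le> sq_norm u z x" for u z
      by (auto simp: sq_norm_def)
    note g = order.trans[OF sq(1) M.grow_bound[OF s x]] order.trans[OF sq(2) M.grow_bound[OF s x]]
      order.trans[OF sq(1) N.grow_bound[OF s x]] order.trans[OF sq(2) N.grow_bound[OF s x]]
    note e = order.trans[OF sq(1) M.decay_bound[OF s x]] order.trans[OF sq(2) M.decay_bound[OF s x]]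
      order.trans[OF sq(1) N.decay_bound[OF s x]] order.trans[OF sq(2) N.decay_bound[OF s x]]
    note [simp] = refl_eq_half_plane[OF s]
    \<comment> \<open>In each medium the solutions \<open>grow\<close> and \<open>decay\<close> form
      the fundamental matrix times the same matrix of initial values, as \<open>g\<close> is common
      to both. That matrix cancels in the transition matrix, and the factor 2 is its
      determinant.\<close>
    have "2 * F s = M.grow_z s x * N.decay_z s x - N.grow_z s x * M.decay_z s x"
      by (simp add: F_def M.grow_z_def N.grow_z_def M.decay_z_def N.decay_z_def algebra_simps)
    then have "norm (2 * F s) \<le> b"
      using norm_triangle_ineq4[of "M.grow_z s x * N.decay_z s x" "N.grow_z s x * M.decay_z s x"]
        prod[OF g(2) e(4)] prod[OF g(4) e(2)] by (simp add: b_def)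
    then have 1: "2 * norm (F s) \<le> b" by (simp add: norm_mult)
    have "2 * G s = N.grow_u s x * M.decay_z s x - M.grow_z s x * N.decay_u s x"
      by (simp add: G_def M.grow_z_def N.grow_u_def M.decay_z_def N.decay_u_def algebra_simps)
    then have "norm (2 * G s) \<le> b"
      using norm_triangle_ineq4[of "N.grow_u s x * M.decay_z s x" "M.grow_z s x * N.decay_u s x"]
        prod[OF g(2) e(3)] prod[OF g(3) e(2)] by (simp add: b_def)
    then have 2: "2 * norm (G s) \<le> b" by (simp add: norm_mult)
    show ?thesis using 1 2 norm_ge_zero[of "F s"] norm_ge_zero[of "G s"] by linarith
  qed
  have all: "norm (F s) \<le> b \<and> norm (G s) \<le> b" for s
  proof (cases "Re s \<le> 0")
    case False
    then have "norm (F (- s)) \<le> b \<and> norm (G (- s)) \<le> b" by (intro half) simp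
    then show ?thesis by (simp add: par)
  qed (rule half)
  have bd: "bounded (range F)" "bounded (range G)" using all by (auto simp: bounded_iff)
  obtain f where f: "\<And>s. F s = f" using Liouville_theorem[OF hol(1) bd(1)] unfolding constant_on_def by auto
  obtain g where g: "\<And>s. G s = g" using Liouville_theorem[OF hol(2) bd(2)] unfolding constant_on_def by auto
  have "F 0 = 0" "G 0 = 1" by (simp_all add: F_def G_def M.columns_0 N.columns_0)
  then have "F s = 0" "G s = 1" using f g by metis+
  then show "sh_z r c s x * ch_z r' c s x - ch_z r c s x * sh_z r' c s x = 0"
    "ch_z r c s x * ch_u r' c s x - sh_z r c s x * sh_u r' c s x = 1" by (simp_all add: F_def G_def)
qed

text \<open>The row \<open>(0, 1)\<close> is multiplied back by the second fundamental matrix, whose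
  determinant is 1.\<close>

lemma sh_z_eq:
  assumes x: "x \<in> {c..d}"
  shows "sh_z r c s x = sh_z r' c s x"
proof -
  note t = transition_const[OF x, of s]
  have "sh_z r c s x = sh_z r c s x * (ch_u r' c s x * ch_z r' c s x - sh_z r' c s x * sh_u r' c s x)"
    using N.columns_det[OF x] by simp
  also have "\<dots> = ch_u r' c s x * (sh_z r c s x * ch_z r' c s x - ch_z r c s x * sh_z r' c s x)
      + sh_z r' c s x * (ch_z r c s x * ch_u r' c s x - sh_z r c s x * sh_u r' c s x)"
    by (simp add: algebra_simps)
  also have "\<dots> = sh_z r' c s x" by (simp add: t)
  finally show ?thesis .
qed

lemma integral_eq:
  assumes x: "x \<in> {c..d}"
  shows "integral {c..x} r = integral {c..x} r'"
proof -
  have "((\<lambda>s. sh_z r c s x) has_field_derivative of_real (integral {c..x} r')) (at 0)"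
    using N.sh_z_deriv_0[OF x] by (simp add: sh_z_eq[OF x])
  with M.sh_z_deriv_0[OF x] have "complex_of_real (integral {c..x} r) = of_real (integral {c..x} r')"
    by (rule DERIV_unique)
  then show ?thesis by simp
qed

lemma medium_eq:
  assumes x: "x \<in> {c<..<d} - (S \<union> S')"
  shows "r x = r' x"
proof -
  have "iter_int p q c (Suc 0) = (\<lambda>t. integral {c..t} p)" for p q by (simp add: fun_eq_iff)
  note i = this[of r] this[of r']
  have D: "((\<lambda>t. integral {c..t} r) has_vector_derivative r x) (at x)"
    using M.A.iter_int_deriv[of x 0] x unfolding i by simp
  have D': "((\<lambda>t. integral {c..t} r') has_vector_derivative r' x) (at x)"
    using N.A.iter_int_deriv[of x 0] x unfolding i by simp
  have "((\<lambda>t. integral {c..t} r) has_vector_derivative r' x) (at x)"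
    by (rule has_vector_derivative_transform_within_open[OF D', of "{c<..<d}"])
       (use x integral_eq in auto)
  with D show ?thesis using vector_derivative_unique_at by blast
qed

end

subsection \<open>The boundary value problem\<close>

lemma abs_continuous_on_subset: "abs_continuous_on S f \<Longrightarrow> T \<subseteq> S \<Longrightarrow> abs_continuous_on T f"
  unfolding abs_continuous_on_def by (meson order.trans)

lemma abs_continuous_imp_uniformly_continuous:
  assumes "abs_continuous_on S f" "is_interval S"
  shows "uniformly_continuous_on S f"
  unfolding uniformly_continuous_on_def
proof (intro allI impI)
  fix e :: real assume "e > 0"
  from abs_continuous_on_uniform[OF assms this] obtain \<delta> where "\<delta> > 0"
    "\<And>x y. x \<in> S \<Longrightarrow> y \<in> S \<Longrightarrow> \<bar>x - y\<bar> < \<delta> \<Longrightarrow> dist (f x) (f y) < e" by blast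
  then show "\<exists>d>0. \<forall>x\<in>S. \<forall>x'\<in>S. dist x' x < d \<longrightarrow> dist (f x') (f x) < e"
    by (intro exI[of _ \<delta>]) (auto simp: dist_real_def)
qed

lemma lipschitz_finite_exceptions:
  fixes f :: "real \<Rightarrow> 'a::banach"
  assumes "finite S" "continuous_on {a..b} f"
    and f': "\<And>x. x \<in> {a<..<b} - S \<Longrightarrow> (f has_vector_derivative f' x) (at x) \<and> norm (f' x) \<le> L"
    and L: "L \<ge> 0" and xy: "x \<in> {a..b}" "y \<in> {a..b}"
  shows "norm (f x - f y) \<le> L * \<bar>x - y\<bar>"
proof -
  have *: "norm (f y - f x) \<le> L * (y - x)" if "x \<in> {a..b}" "y \<in> {a..b}" "x \<le> y" for x y
  proof -
    let ?g = "\<lambda>t. if t \<in> {x<..<y} - S then f' t else 0"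
    have sub: "{x<..<y} \<subseteq> {a<..<b}" "{x..y} \<subseteq> {a..b}" using that by auto
    have "(?g has_integral (f y - f x)) {x..y}"
    proof (rule fundamental_theorem_of_calculus_interior_strong[OF assms(1) that(3)])
      show "continuous_on {x..y} f" by (rule continuous_on_subset[OF assms(2) sub(2)])
    qed (use f' sub(1) in auto)
    then have "(?g has_integral (f y - f x)) (cbox x y)" by (simp add: box_real)
    then have "norm (f y - f x) \<le> L * measure lborel (cbox x y)"
      by (rule has_integral_bound[OF L]) (use f' sub(1) L in auto)
    then show ?thesis using that by simp
  qed
  show ?thesis
  proof (cases "x \<le> y")
    case True
    then show ?thesis using *[OF xy] by (simp add: norm_minus_commute)
  next
    case False
    then show ?thesis using *[OF xy(2,1)] by simp
  qed
qed

text \<open>This turns an equation holding almost everywhere into a classical one: minus the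
  primitive of \<open>f\<close>, the function is absolutely continuous with derivative zero almost
  everywhere, hence constant.\<close>

lemma abs_continuous_has_vector_derivative:
  fixes u f :: "real \<Rightarrow> 'a::banach"
  assumes u: "abs_continuous_on {a<..<b} u" and f: "continuous_on {a..b} f"
    and ae: "AE x in lebesgue. x \<in> {a<..<b} \<longrightarrow> (u has_vector_derivative f x) (at x)"
    and x: "x \<in> {a<..<b}"
  shows "(u has_vector_derivative f x) (at x)"
proof -
  define w where "w y = integral {a..y} f" for y
  have w: "(w has_vector_derivative f y) (at y)" if "y \<in> {a<..<b}" for y
    using integral_has_vector_derivative[OF f, of y] that
    by (simp add: w_def[abs_def] at_within_Icc_at)
  have "compact (f ` {a..b})" by (intro compact_continuous_image f) simp
  then obtain L where L: "L > 0" "\<And>t. t \<in> {a..b} \<Longrightarrow> norm (f t) \<le> L"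
    using compact_imp_bounded[of "f ` {a..b}"] unfolding bounded_pos by auto
  have "continuous_on {a..b} w"
    unfolding w_def[abs_def] by (intro indefinite_integral_continuous_1 integrable_continuous_interval f)
  then have "norm (w y - w y') \<le> L * \<bar>y - y'\<bar>" if "y \<in> {a<..<b}" "y' \<in> {a<..<b}" for y y'
    using that L w by (intro lipschitz_finite_exceptions[of "{}" a b w f]) auto
  then have ac: "abs_continuous_on {a<..<b} (\<lambda>y. u y - w y)"
    by (rule abs_continuous_on_diff_lipschitz[OF u])
  have "AE y in lebesgue. y \<in> {a<..<b} \<longrightarrow> ((\<lambda>y. u y - w y) has_vector_derivative 0) (at y)"
    using ae
  proof eventually_elim
    case (elim y)
    show ?case
    proof
      assume y: "y \<in> {a<..<b}"
      from has_vector_derivative_diff[OF _ w[OF y]] elim y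
      have "((\<lambda>y. u y - w y) has_vector_derivative (f y - f y)) (at y)" by blast
      then show "((\<lambda>y. u y - w y) has_vector_derivative 0) (at y)" by simp
    qed
  qed
  then have const: "u y - w y = u x - w x" if "y \<in> {a<..<b}" for y
    using abs_continuous_derivative_zero_imp_const[OF ac _ that x] by blast
  have "((\<lambda>y. w y + (u x - w x)) has_vector_derivative (f x + 0)) (at x)"
    by (intro has_vector_derivative_add w x has_vector_derivative_const)
  then have "((\<lambda>y. w y + (u x - w x)) has_vector_derivative f x) (at x)" by simp
  then show ?thesis
  proof (rule has_vector_derivative_transform_within_open[of _ _ _ "{a<..<b}"])
    show "w y + (u x - w x) = u y" if "y \<in> {a<..<b}" for y
      using const[OF that] by (simp add: algebra_simps)
  qed (use x in auto)
qed

text \<open>The set of disagreement is open and null, hence empty.\<close>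

lemma ae_equal_continuous_imp_equal:
  fixes f g :: "real \<Rightarrow> 'a::metric_space"
  assumes ae: "ae_equal_on T f g" and U: "open U" "U \<subseteq> T"
    and fg: "continuous_on U f" "continuous_on U g" and x: "x \<in> U"
  shows "f x = g x"
proof (rule ccontr)
  assume "f x \<noteq> g x"
  let ?D = "U \<inter> (\<lambda>x. dist (f x) (g x)) -` {0<..}"
  have "continuous_on U (\<lambda>x. dist (f x) (g x))" by (intro continuous_intros fg)
  then have op: "open ?D" using U(1) by (rule continuous_open_preimage) simp
  have ae_D: "AE x in lebesgue. x \<notin> ?D"
    using ae[unfolded ae_equal_on_def] by eventually_elim (use U(2) in auto)
  have "?D \<in> sets lebesgue" using op by simp
  then have "?D \<in> null_sets lebesgue" using ae_D by (rule AE_iff_null_sets[THEN iffD2])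
  then have "negligible ?D" by (rule negligible_iff_null_sets[THEN iffD2])
  then have "?D = {}" using op open_not_negligible by blast
  moreover have "x \<in> ?D" using \<open>f x \<noteq> g x\<close> x by simp
  ultimately show False by blast
qed

text \<open>Here \<open>\<zeta>\<close> is the given representative and \<open>r\<close> its tame
  replacement. The free parameter \<open>\<kappa>\<close> becomes the left limit at
  \<open>x1\<close>, so that the right boundary condition with \<open>\<xi> = 0\<close> says that
  the wave leaves without reflection.\<close>

locale impedance = medium x0 x1 r S m K \<kappa> C
  for x0 x1 r S m K \<kappa> C +
  fixes \<zeta> :: "real \<Rightarrow> real"
  assumes r_eq: "\<And>x. x \<in> {x0<..<x1} - S \<Longrightarrow> r x = \<zeta> x"
    and \<zeta>_pos: "\<And>x. x \<in> {x0<..<x1} \<Longrightarrow> \<zeta> x > 0"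
    and \<zeta>_left: "(\<zeta> \<longlongrightarrow> 1) (at_right x0)"
    and \<zeta>_right: "(\<zeta> \<longlongrightarrow> \<kappa>) (at_left x1)"
begin

lemma open_regular: "open ({x0<..<x1} - S)"
  by (intro open_Diff finite_imp_closed finS) auto

lemma \<zeta>_continuous: "continuous_on ({x0<..<x1} - S) \<zeta>"
proof -
  have "continuous_on ({x0<..<x1} - S) r"
    using cont by (intro continuous_at_imp_continuous_on) auto
  then show ?thesis by (subst (asm) continuous_on_cong[OF refl r_eq]) auto
qed

lemma ev_left: "eventually (\<lambda>x. x \<in> {x0<..<x1}) (at_right x0)"
  using eventually_at_right[OF cd] cd by auto

lemma ev_right: "eventually (\<lambda>x. x \<in> {x0<..<x1}) (at_left x1)"
  using eventually_at_left[OF cd] cd by auto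

lemma system_limits:
  assumes "system_on {x0..x1} S r s u z"
  shows "(u \<longlongrightarrow> u x0) (at_right x0)" "(z \<longlongrightarrow> z x0) (at_right x0)"
    "(u \<longlongrightarrow> u x1) (at_left x1)" "(z \<longlongrightarrow> z x1) (at_left x1)"
  using assms cd unfolding system_on_def
  by (auto intro: continuous_on_Icc_at_rightD continuous_on_Icc_at_leftD)

text \<open>On the open interval \<open>u' = s z / \<zeta>\<close>, so the amplitudes are \<open>(u \<plusminus> z / \<zeta>) / 2\<close>.\<close>

lemma amplitude_limits:
  assumes \<omega>: "\<omega> \<noteq> 0" and sol: "system_on {x0..x1} S r s u z"
    and u': "\<And>x. x \<in> {x0<..<x1} \<Longrightarrow> u' x = u x"
    and du: "\<And>x. x \<in> {x0<..<x1} \<Longrightarrow> of_real (\<zeta> x) * du x = \<i> * of_real \<omega> * z x"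
  shows "(right_part \<omega> u' du \<longlongrightarrow> 1/2 * (u x0 + z x0)) (at_right x0)"
    "(left_part \<omega> u' du \<longlongrightarrow> 1/2 * (u x0 - z x0)) (at_right x0)"
    "(right_part \<omega> u' du \<longlongrightarrow> 1/2 * (u x1 + z x1 / of_real \<kappa>)) (at_left x1)"
    "(left_part \<omega> u' du \<longlongrightarrow> 1/2 * (u x1 - z x1 / of_real \<kappa>)) (at_left x1)"
proof -
  have eq: "1/2 * (u x + z x / of_real (\<zeta> x)) = right_part \<omega> u' du x"
    "1/2 * (u x - z x / of_real (\<zeta> x)) = left_part \<omega> u' du x" if "x \<in> {x0<..<x1}" for x
  proof -
    have "du x = \<i> * of_real \<omega> * z x / of_real (\<zeta> x)"
      using du[OF that] \<zeta>_pos[OF that] by (simp add: field_simps)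
    then have "1 / (\<i> * of_real \<omega>) * du x = z x / of_real (\<zeta> x)" using \<omega> by simp
    then show "1/2 * (u x + z x / of_real (\<zeta> x)) = right_part \<omega> u' du x"
      "1/2 * (u x - z x / of_real (\<zeta> x)) = left_part \<omega> u' du x"
      by (simp_all only: right_part_def left_part_def u'[OF that])
  qed
  note lim = system_limits[OF sol]
  have "((\<lambda>x. 1/2 * (u x + z x / of_real (\<zeta> x))) \<longlongrightarrow> 1/2 * (u x0 + z x0 / of_real 1)) (at_right x0)"
    "((\<lambda>x. 1/2 * (u x - z x / of_real (\<zeta> x))) \<longlongrightarrow> 1/2 * (u x0 - z x0 / of_real 1)) (at_right x0)"
    "((\<lambda>x. 1/2 * (u x + z x / of_real (\<zeta> x))) \<longlongrightarrow> 1/2 * (u x1 + z x1 / of_real \<kappa>)) (at_left x1)"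
    "((\<lambda>x. 1/2 * (u x - z x / of_real (\<zeta> x))) \<longlongrightarrow> 1/2 * (u x1 - z x1 / of_real \<kappa>)) (at_left x1)"
    using lim \<zeta>_left \<zeta>_right \<kappa> by (intro tendsto_intros; simp)+
  note L = this
  show "(right_part \<omega> u' du \<longlongrightarrow> 1/2 * (u x0 + z x0)) (at_right x0)"
    using Lim_transform_eventually[OF L(1) eventually_mono[OF ev_left eq(1)]] by simp
  show "(left_part \<omega> u' du \<longlongrightarrow> 1/2 * (u x0 - z x0)) (at_right x0)"
    using Lim_transform_eventually[OF L(2) eventually_mono[OF ev_left eq(2)]] by simp
  show "(right_part \<omega> u' du \<longlongrightarrow> 1/2 * (u x1 + z x1 / of_real \<kappa>)) (at_left x1)"
    by (rule Lim_transform_eventually[OF L(3) eventually_mono[OF ev_right eq(1)]])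
  show "(left_part \<omega> u' du \<longlongrightarrow> 1/2 * (u x1 - z x1 / of_real \<kappa>)) (at_left x1)"
    by (rule Lim_transform_eventually[OF L(4) eventually_mono[OF ev_right eq(2)]])
qed

text \<open>Around a point outside \<open>S\<close> the function \<open>du\<close> is continuous,
  being the quotient of the absolutely continuous \<open>\<zeta> du\<close> by the continuous
  \<open>\<zeta>\<close>. Hence both equations, assumed almost everywhere, hold at every such
  point.\<close>

lemma helmholtz_imp_system:
  assumes \<omega>: "\<omega> \<noteq> 0" and sol: "helmholtz_solution x0 x1 \<zeta> \<omega> u du"
  defines "z \<equiv> \<lambda>x. of_real (\<zeta> x) * du x / (\<i> * of_real \<omega>)"
  shows "system_on {x0<..<x1} S r (\<i> * of_real \<omega>) u z"
proof -
  define v where "v = (\<lambda>x. complex_of_real (\<zeta> x) * du x)"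
  have ac: "abs_continuous_on {x0<..<x1} u" "abs_continuous_on {x0<..<x1} v"
    and ae: "AE x in lebesgue. x \<in> {x0<..<x1} \<longrightarrow> (u has_vector_derivative du x) (at x)"
      "AE x in lebesgue. x \<in> {x0<..<x1} \<longrightarrow> (\<exists>d. (v has_vector_derivative d) (at x) \<and>
        d + (of_real \<omega>)\<^sup>2 * of_real (\<zeta> x) * u x = 0)"
    using sol unfolding helmholtz_solution_def v_def by auto
  have cu: "continuous_on {x0<..<x1} u" "continuous_on {x0<..<x1} v"
    using ac abs_continuous_imp_uniformly_continuous is_interval_oo uniformly_continuous_imp_continuous by blast+
  have z_v: "z = (\<lambda>x. v x / (\<i> * of_real \<omega>))" by (simp add: z_def v_def)
  have D: "(u has_vector_derivative du x) (at x) \<and>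
      (v has_vector_derivative - ((of_real \<omega>)\<^sup>2 * of_real (\<zeta> x) * u x)) (at x)"
    if x: "x \<in> {x0<..<x1} - S" for x
  proof -
    obtain e where e: "e > 0" "cball x e \<subseteq> {x0<..<x1} - S"
      using open_regular x open_contains_cball by metis
    define a b where "a = x - e" and "b = x + e"
    have ab: "x \<in> {a<..<b}" "{a..b} \<subseteq> {x0<..<x1} - S" "{a<..<b} \<subseteq> {x0<..<x1}"
    proof -
      have "{a..b} = cball x e" by (simp add: a_def b_def cball_eq_atLeastAtMost)
      with e(2) show 1: "{a..b} \<subseteq> {x0<..<x1} - S" by simp
      have "{a<..<b} \<subseteq> {a..b}" by auto
      with 1 show "{a<..<b} \<subseteq> {x0<..<x1}" by blast
      show "x \<in> {a<..<b}" using e(1) by (simp add: a_def b_def)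
    qed
    have cont_ab: "continuous_on {a..b} \<zeta>" "continuous_on {a..b} u" "continuous_on {a..b} v"
      using continuous_on_subset[OF \<zeta>_continuous] continuous_on_subset[OF cu(1)]
        continuous_on_subset[OF cu(2)] ab(2) by blast+
    have pos: "\<zeta> t \<noteq> 0" if "t \<in> {a..b}" for t using \<zeta>_pos[of t] ab(2) that by auto
    have "continuous_on {a..b} (\<lambda>t. v t / of_real (\<zeta> t))"
      using pos by (intro continuous_intros cont_ab) auto
    then have cdu: "continuous_on {a..b} du"
      by (rule continuous_on_eq) (use pos in \<open>simp add: v_def\<close>)
    have "AE t in lebesgue. t \<in> {a<..<b} \<longrightarrow> (u has_vector_derivative du t) (at t)"
      using ae(1) by eventually_elim (use ab(3) in blast)
    then have "(u has_vector_derivative du x) (at x)"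
      by (rule abs_continuous_has_vector_derivative[OF abs_continuous_on_subset[OF ac(1) ab(3)] cdu _ ab(1)])
    moreover have "(v has_vector_derivative - ((of_real \<omega>)\<^sup>2 * of_real (\<zeta> x) * u x)) (at x)"
    proof (rule abs_continuous_has_vector_derivative[OF abs_continuous_on_subset[OF ac(2) ab(3)] _ _ ab(1)])
      show "continuous_on {a..b} (\<lambda>x. - ((of_real \<omega>)\<^sup>2 * of_real (\<zeta> x) * u x))"
        by (intro continuous_intros cont_ab)
      show "AE x in lebesgue. x \<in> {a<..<b} \<longrightarrow>
          (v has_vector_derivative - ((of_real \<omega>)\<^sup>2 * of_real (\<zeta> x) * u x)) (at x)"
        using ae(2)
      proof eventually_elim
        case (elim t)
        show ?case
        proof
          assume "t \<in> {a<..<b}"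
          with elim ab(3) obtain d where "(v has_vector_derivative d) (at t)"
            "d + (of_real \<omega>)\<^sup>2 * of_real (\<zeta> t) * u t = 0" by blast
          then show "(v has_vector_derivative - ((of_real \<omega>)\<^sup>2 * of_real (\<zeta> t) * u t)) (at t)"
            by (simp add: add_eq_0_iff2)
        qed
      qed
    qed
    ultimately show ?thesis by blast
  qed
  show ?thesis
    unfolding system_on_def
  proof (intro conjI ballI)
    show "continuous_on {x0<..<x1} u" by (rule cu)
    show "continuous_on {x0<..<x1} z" unfolding z_v using \<omega> by (intro continuous_intros cu) auto
    fix x assume "x \<in> interior {x0<..<x1} - S"
    then have x: "x \<in> {x0<..<x1} - S" by (simp add: interior_open)
    have rx: "r x = \<zeta> x" "\<zeta> x > 0" using r_eq[OF x] \<zeta>_pos x by auto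
    have "du x = \<i> * of_real \<omega> * z x / of_real (r x)" using rx \<omega> by (simp add: z_def)
    then show "(u has_vector_derivative \<i> * of_real \<omega> * z x / of_real (r x)) (at x)" using D[OF x] by simp
    have "(z has_vector_derivative - ((of_real \<omega>)\<^sup>2 * of_real (\<zeta> x) * u x) / (\<i> * of_real \<omega>)) (at x)"
      unfolding z_v using D[OF x] by (intro has_vector_derivative_divide) blast
    moreover have "- ((of_real \<omega>)\<^sup>2 * of_real (\<zeta> x) * u x) / (\<i> * of_real \<omega>) = \<i> * of_real \<omega> * of_real (r x) * u x"
      using \<omega> rx by (simp add: field_simps power2_eq_square)
    ultimately show "(z has_vector_derivative \<i> * of_real \<omega> * of_real (r x) * u x) (at x)" by simp
  qed
qed

lemma bvp_solution_imp_refl: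
  assumes \<omega>: "\<omega> \<noteq> 0" and bvp: "bvp_solution x0 x1 \<zeta> \<omega> 0 u du"
    and g: "(left_part \<omega> u du \<longlongrightarrow> g) (at_right x0)"
  shows "g = reflection r x0 x1 \<kappa> (\<i> * of_real \<omega>)"
proof -
  let ?s = "\<i> * complex_of_real \<omega>"
  define z where "z = (\<lambda>x. of_real (\<zeta> x) * du x / ?s)"
  have sys: "system_on {x0<..<x1} S r ?s u z"
    unfolding z_def using bvp by (intro helmholtz_imp_system[OF \<omega>]) (simp add: bvp_solution_def)
  have cols: "system_on {x0<..<x1} S r ?s (ch_u r x0 ?s) (sh_z r x0 ?s)"
    "system_on {x0<..<x1} S r ?s (sh_u r x0 ?s) (ch_z r x0 ?s)"
    by (rule system_on_subset[OF system_on_columns(1)] system_on_subset[OF system_on_columns(2)]; auto)+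
  obtain k l where kl: "\<And>x. x \<in> {x0<..<x1} \<Longrightarrow> u x = k * ch_u r x0 ?s x + l * sh_u r x0 ?s x"
    "\<And>x. x \<in> {x0<..<x1} \<Longrightarrow> z x = k * sh_z r x0 ?s x + l * ch_z r x0 ?s x"
    by (rule system_on_represent[OF finS is_interval_oo sys cols columns_det]) auto
  \<comment> \<open>The values of \<open>u\<close> and \<open>du\<close> at the end points are
    arbitrary. \<open>U\<close> and \<open>Z\<close> are the continuous extensions to the closed
    interval, which carry the one-sided limits.\<close>
  define U Z where "U = (\<lambda>x. k * ch_u r x0 ?s x + l * sh_u r x0 ?s x)"
    and "Z = (\<lambda>x. k * sh_z r x0 ?s x + l * ch_z r x0 ?s x)"
  have sysU: "system_on {x0..x1} S r ?s U Z"
    unfolding U_def Z_def by (intro system_on_combine system_on_columns)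
  have start: "U x0 = k" "Z x0 = l" by (simp_all add: U_def Z_def columns_start)
  have uU: "u x = U x" if "x \<in> {x0<..<x1}" for x using kl that by (simp add: U_def)
  have duZ: "of_real (\<zeta> x) * du x = \<i> * of_real \<omega> * Z x" if "x \<in> {x0<..<x1}" for x
    using kl(2)[OF that] \<omega> by (simp add: Z_def z_def field_simps)
  note lim = amplitude_limits[OF \<omega> sysU uU duZ]
  have "(right_part \<omega> u du \<longlongrightarrow> 1) (at_right x0)" using bvp by (simp add: bvp_solution_def)
  then have "1/2 * (k + l) = 1" using lim(1) start by (intro tendsto_unique[OF trivial_limit_at_right_real]) auto
  moreover have "1/2 * (k - l) = g" using lim(2) g start by (intro tendsto_unique[OF trivial_limit_at_right_real]) auto
  ultimately have kl_g: "k = 1 + g" "l = 1 - g" by algebra+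
  have "(left_part \<omega> u du \<longlongrightarrow> 0) (at_left x1)" using bvp by (auto simp: bvp_solution_def)
  then have "1/2 * (U x1 - Z x1 / of_real \<kappa>) = 0"
    using lim(4) by (intro tendsto_unique[OF trivial_limit_at_left_real]) auto
  then have "of_real \<kappa> * U x1 = Z x1" using \<kappa> by (simp add: field_simps)
  then have "g * amp_right r x0 x1 \<kappa> ?s = amp_left r x0 x1 \<kappa> ?s"
    unfolding U_def Z_def kl_g amp_right_def amp_left_def by algebra
  then show ?thesis using amp_right_lower(2)[of ?s] by (simp add: reflection_def field_simps)
qed

lemma system_on_lipschitz:
  assumes sol: "system_on {x0..x1} S r s u z"
  obtains L where "\<And>x y. x \<in> {x0..x1} \<Longrightarrow> y \<in> {x0..x1} \<Longrightarrow> norm (u x - u y) \<le> L * \<bar>x - y\<bar>"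
    "\<And>x y. x \<in> {x0..x1} \<Longrightarrow> y \<in> {x0..x1} \<Longrightarrow> norm (z x - z y) \<le> L * \<bar>x - y\<bar>"
proof -
  have cont: "continuous_on {x0..x1} u" "continuous_on {x0..x1} z" using sol by (auto simp: system_on_def)
  have bd: "bounded (u ` {x0..x1})" "bounded (z ` {x0..x1})"
    by (intro compact_imp_bounded compact_continuous_image cont; simp)+
  obtain A where A: "\<And>x. x \<in> {x0..x1} \<Longrightarrow> norm (u x) \<le> A" using bd(1) unfolding bounded_iff by blast
  obtain B where B: "\<And>x. x \<in> {x0..x1} \<Longrightarrow> norm (z x) \<le> B" using bd(2) unfolding bounded_iff by blast
  note AB = A B
  define M where "M = max K (1 / m)"
  have M: "\<bar>r x\<bar> \<le> M" "\<bar>1 / r x\<bar> \<le> M" for x using inverse_bounds by (auto simp: M_def)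
  have M0: "M \<ge> 0" using M(1)[of 0] by linarith
  define L where "L = norm s * M * max A B"
  have max: "0 \<le> max A B"
    using order.trans[OF norm_ge_zero A[of x0]] cd by (simp add: le_max_iff_disj)
  have L: "L \<ge> 0" using M0 max by (simp add: L_def)
  have D: "(u has_vector_derivative s * z x / of_real (r x)) (at x)" "norm (s * z x / of_real (r x)) \<le> L"
      "(z has_vector_derivative s * of_real (r x) * u x) (at x)" "norm (s * of_real (r x) * u x) \<le> L"
    if x: "x \<in> {x0<..<x1} - S" for x
  proof -
    show "(u has_vector_derivative s * z x / of_real (r x)) (at x)"
      "(z has_vector_derivative s * of_real (r x) * u x) (at x)"
      using sol x by (auto simp: system_on_def)
    have zu: "norm (z x) \<le> max A B" "norm (u x) \<le> max A B" using AB[of x] x by auto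
    have "norm s * \<bar>1 / r x\<bar> * norm (z x) \<le> L"
      unfolding L_def using M zu M0 max by (intro mult_mono) auto
    then show "norm (s * z x / of_real (r x)) \<le> L" by (simp add: norm_mult norm_divide)
    have "norm s * \<bar>r x\<bar> * norm (u x) \<le> L"
      unfolding L_def using M zu M0 max by (intro mult_mono) auto
    then show "norm (s * of_real (r x) * u x) \<le> L" by (simp add: norm_mult)
  qed
  show thesis
  proof (rule that)
    fix x y assume xy: "x \<in> {x0..x1}" "y \<in> {x0..x1}"
    show "norm (u x - u y) \<le> L * \<bar>x - y\<bar>"
      by (rule lipschitz_finite_exceptions[OF finS cont(1) _ L xy]) (use D in blast)
    show "norm (z x - z y) \<le> L * \<bar>x - y\<bar>"
      by (rule lipschitz_finite_exceptions[OF finS cont(2) _ L xy]) (use D in blast)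
  qed
qed

lemma ae_not_S: "AE x in lebesgue. x \<notin> S"
  using finS by (intro AE_not_in) (simp add: negligible_iff_null_sets[symmetric] negligible_finite)

text \<open>The solution starting at \<open>(1 + g, 1 - g)\<close> has the prescribed amplitudes at
  the left end. The condition at the right end is the defining quotient of \<open>g\<close> with its
  denominator cleared.\<close>

lemma bvp_solution_exists:
  assumes \<omega>: "\<omega> \<noteq> 0"
  shows "\<exists>u du. bvp_solution x0 x1 \<zeta> \<omega> 0 u du \<and>
    (left_part \<omega> u du \<longlongrightarrow> reflection r x0 x1 \<kappa> (\<i> * of_real \<omega>)) (at_right x0)"
proof -
  let ?s = "\<i> * complex_of_real \<omega>"
  define g where "g = reflection r x0 x1 \<kappa> ?s"
  define u z where "u = (\<lambda>x. (1 + g) * ch_u r x0 ?s x + (1 - g) * sh_u r x0 ?s x)"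
    and "z = (\<lambda>x. (1 + g) * sh_z r x0 ?s x + (1 - g) * ch_z r x0 ?s x)"
  have sys: "system_on {x0..x1} S r ?s u z"
    unfolding u_def z_def by (intro system_on_combine system_on_columns)
  have start: "u x0 = 1 + g" "z x0 = 1 - g" by (simp_all add: u_def z_def columns_start)
  define du where "du x = ?s * z x / of_real (\<zeta> x)" for x
  have v: "of_real (\<zeta> x) * du x = ?s * z x" if "x \<in> {x0<..<x1}" for x
    using \<zeta>_pos[OF that] by (simp add: du_def)
  obtain L where L: "\<And>x y. x \<in> {x0..x1} \<Longrightarrow> y \<in> {x0..x1} \<Longrightarrow> norm (u x - u y) \<le> L * \<bar>x - y\<bar>"
    "\<And>x y. x \<in> {x0..x1} \<Longrightarrow> y \<in> {x0..x1} \<Longrightarrow> norm (z x - z y) \<le> L * \<bar>x - y\<bar>"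
    using system_on_lipschitz[OF sys] by blast
  have D: "(u has_vector_derivative du x) (at x)"
    "((\<lambda>x. of_real (\<zeta> x) * du x) has_vector_derivative ?s * (?s * of_real (\<zeta> x) * u x)) (at x)"
    if x: "x \<in> {x0<..<x1} - S" for x
  proof -
    have "(u has_vector_derivative ?s * z x / of_real (r x)) (at x)"
      "(z has_vector_derivative ?s * of_real (r x) * u x) (at x)"
      using sys x by (auto simp: system_on_def)
    then have d: "(u has_vector_derivative du x) (at x)"
      "(z has_vector_derivative ?s * of_real (\<zeta> x) * u x) (at x)"
      unfolding r_eq[OF x] du_def by auto
    then show "(u has_vector_derivative du x) (at x)" by blast
    show "((\<lambda>x. of_real (\<zeta> x) * du x) has_vector_derivative ?s * (?s * of_real (\<zeta> x) * u x)) (at x)"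
      by (rule has_vector_derivative_transform_within_open[OF has_vector_derivative_mult_right[OF d(2)], of "{x0<..<x1}"])
        (use x v in auto)
  qed
  have hs: "helmholtz_solution x0 x1 \<zeta> \<omega> u du"
    unfolding helmholtz_solution_def
  proof (intro conjI)
    show "abs_continuous_on {x0<..<x1} u"
      by (rule lipschitz_imp_abs_continuous_on[of _ _ L]) (use L(1) in auto)
    show "abs_continuous_on {x0<..<x1} (\<lambda>x. of_real (\<zeta> x) * du x)"
    proof (rule lipschitz_imp_abs_continuous_on[of _ _ "norm ?s * L"])
      fix x y assume xy: "x \<in> {x0<..<x1}" "y \<in> {x0<..<x1}"
      have "of_real (\<zeta> x) * du x - of_real (\<zeta> y) * du y = ?s * (z x - z y)"
        unfolding v[OF xy(1)] v[OF xy(2)] by (simp add: algebra_simps)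
      moreover have "norm ?s * norm (z x - z y) \<le> norm ?s * (L * \<bar>x - y\<bar>)"
        using L(2)[of x y] xy by (intro mult_left_mono) auto
      ultimately show "norm (of_real (\<zeta> x) * du x - of_real (\<zeta> y) * du y) \<le> norm ?s * L * \<bar>x - y\<bar>"
        by (simp only: norm_mult mult.assoc)
    qed
    show "AE x in lebesgue. x \<in> {x0<..<x1} \<longrightarrow> (u has_vector_derivative du x) (at x)"
      using ae_not_S by eventually_elim (use D(1) in blast)
    show "AE x in lebesgue. x \<in> {x0<..<x1} \<longrightarrow>
        (\<exists>d. ((\<lambda>x. of_real (\<zeta> x) * du x) has_vector_derivative d) (at x) \<and>
             d + (of_real \<omega>)\<^sup>2 * of_real (\<zeta> x) * u x = 0)"
      using ae_not_S
    proof eventually_elim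
      case (elim x)
      have "?s * (?s * of_real (\<zeta> x) * u x) + (of_real \<omega>)\<^sup>2 * of_real (\<zeta> x) * u x = 0"
        by (simp add: power2_eq_square algebra_simps)
      then show ?case using D(2) elim by blast
    qed
  qed
  have "amp_right r x0 x1 \<kappa> ?s \<noteq> 0" by (rule amp_right_lower(2)) simp
  then have gA: "g * amp_right r x0 x1 \<kappa> ?s = amp_left r x0 x1 \<kappa> ?s" by (simp add: g_def reflection_def)
  have "of_real \<kappa> * u x1 = z x1"
    using gA unfolding u_def z_def amp_right_def amp_left_def by algebra
  then have end0: "u x1 - z x1 / of_real \<kappa> = 0" using \<kappa> by (simp add: field_simps)
  note lim = amplitude_limits[OF \<omega> sys refl v]
  have "bvp_solution x0 x1 \<zeta> \<omega> 0 u du"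
    unfolding bvp_solution_def
    using hs lim(1,3,4) unfolding start end0 by auto
  moreover have "(left_part \<omega> u du \<longlongrightarrow> g) (at_right x0)" using lim(2) unfolding start by simp
  ultimately show ?thesis unfolding g_def by blast
qed

text \<open>As \<open>amp_right\<close> has no zeros on the imaginary axis, 0 is the only
  exceptional frequency.\<close>

lemma gen_refl_coeff_eq:
  assumes "\<omega> \<noteq> 0"
  shows "gen_refl_coeff x0 x1 \<zeta> \<omega> 0 = reflection r x0 x1 \<kappa> (\<i> * of_real \<omega>)"
  unfolding gen_refl_coeff_def
  by (rule the_equality) (use bvp_solution_exists[OF assms] bvp_solution_imp_refl[OF assms] in blast)+

text \<open>The quotient is holomorphic in a neighbourhood of the imaginary axis, so by the chain
  rule the \<open>n\<close>-th derivative in \<open>\<omega>\<close> is \<open>\<i> ^ n\<close>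
  times the \<open>n\<close>-th complex derivative.\<close>

lemma refl_bounded_smooth: "(\<lambda>\<omega>. reflection r x0 x1 \<kappa> (\<i> * of_real \<omega>)) \<in> bounded_smooth"
proof -
  define \<Omega> where "\<Omega> = {s. amp_right r x0 x1 \<kappa> s \<noteq> 0}"
  define F where "F = reflection r x0 x1 \<kappa>"
  have op: "open \<Omega>"
  proof -
    have "continuous_on UNIV (amp_right r x0 x1 \<kappa>)"
      using amp_holomorphic(1) holomorphic_on_imp_continuous_on by blast
    then show ?thesis unfolding \<Omega>_def by (intro open_Collect_neq continuous_on_const)
  qed
  have F: "F holomorphic_on \<Omega>"
    unfolding F_def reflection_def[abs_def] by (intro holomorphic_intros amp_holomorphic) (auto simp: \<Omega>_def)
  have im: "\<i> * of_real \<omega> \<in> \<Omega>" for \<omega> by (simp add: \<Omega>_def amp_right_lower)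
  have D: "((\<lambda>\<omega>. \<i> ^ n * (deriv ^^ n) F (\<i> * of_real \<omega>)) has_vector_derivative
      \<i> ^ Suc n * (deriv ^^ Suc n) F (\<i> * of_real \<omega>)) (at \<omega>)" for n \<omega>
  proof -
    have "((deriv ^^ n) F has_field_derivative deriv ((deriv ^^ n) F) (\<i> * of_real \<omega>)) (at (\<i> * of_real \<omega>))"
      by (rule holomorphic_derivI[OF holomorphic_higher_deriv[OF F op] op im])
    moreover have "((\<lambda>\<omega>. \<i> * complex_of_real \<omega>) has_vector_derivative \<i> * of_real 1) (at \<omega>)"
      by (intro has_vector_derivative_mult_right has_vector_derivative_of_real DERIV_ident)
    ultimately have "((\<lambda>\<omega>. (deriv ^^ n) F (\<i> * of_real \<omega>)) has_vector_derivative
        \<i> * 1 * deriv ((deriv ^^ n) F) (\<i> * of_real \<omega>)) (at \<omega>)"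
      using field_vector_diff_chain_at[of "\<lambda>\<omega>. \<i> * complex_of_real \<omega>" "\<i> * 1" \<omega> "(deriv ^^ n) F"]
      by (simp add: o_def)
    from has_vector_derivative_mult_right[OF this, of "\<i> ^ n"] show ?thesis by (simp add: mult_ac)
  qed
  have it: "((\<lambda>h x. vector_derivative h (at x)) ^^ n) (\<lambda>\<omega>. F (\<i> * of_real \<omega>)) =
      (\<lambda>\<omega>. \<i> ^ n * (deriv ^^ n) F (\<i> * of_real \<omega>))" for n
  proof (induction n)
    case (Suc n)
    show ?case
      unfolding funpow.simps o_def Suc.IH by (rule ext) (rule vector_derivative_at[OF D[of n, unfolded funpow.simps o_def]])
  qed simp
  have "((\<lambda>h x. vector_derivative h (at x)) ^^ n) (\<lambda>\<omega>. F (\<i> * of_real \<omega>)) differentiable_on UNIV" for n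
    unfolding it differentiable_on_def
    using D[of n] differentiable_at_withinI differentiableI_vector by blast
  moreover have "bounded (range (\<lambda>\<omega>. F (\<i> * of_real \<omega>)))"
    unfolding F_def bounded_iff using norm_refl_le_1 by (intro exI[of _ 1]) auto
  ultimately show ?thesis by (simp add: bounded_smooth_def F_def)
qed

lemma refl_coeff_eq: "refl_coeff x0 x1 \<zeta> = (\<lambda>\<omega>. reflection r x0 x1 \<kappa> (\<i> * of_real \<omega>))"
  unfolding refl_coeff_def
proof (rule the_equality)
  let ?G = "\<lambda>\<omega>. reflection r x0 x1 \<kappa> (\<i> * of_real \<omega>)"
  have ae0: "AE \<omega> in lebesgue. \<omega> \<noteq> (0::real)"
    using AE_not_in[of "{0}" lebesgue] by (simp add: negligible_iff_null_sets[symmetric])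
  then have ae: "ae_equal_on UNIV ?G (\<lambda>\<omega>. gen_refl_coeff x0 x1 \<zeta> \<omega> 0)"
    unfolding ae_equal_on_def by eventually_elim (simp add: gen_refl_coeff_eq)
  then show "?G \<in> bounded_smooth \<and> ae_equal_on UNIV ?G (\<lambda>\<omega>. gen_refl_coeff x0 x1 \<zeta> \<omega> 0)"
    using refl_bounded_smooth by blast
  have cont: "continuous_on UNIV G" if "G \<in> bounded_smooth" for G
    using that differentiable_imp_continuous_on unfolding bounded_smooth_def
    by (metis (mono_tags, lifting) funpow_0 mem_Collect_eq)
  fix G assume G: "G \<in> bounded_smooth \<and> ae_equal_on UNIV G (\<lambda>\<omega>. gen_refl_coeff x0 x1 \<zeta> \<omega> 0)"
  then have "ae_equal_on UNIV G ?G"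
    using ae unfolding ae_equal_on_def by (auto elim: eventually_elim2)
  then show "G = ?G"
    using G refl_bounded_smooth cont
    by (intro ext ae_equal_continuous_imp_equal[of UNIV G ?G UNIV]) auto
qed

end

section \<open>From the impedance class to a tame representative\<close>

lemma interval_partition_bounds:
  assumes "interval_partition x0 x1 n p" "i \<le> n"
  shows "x0 \<le> p i" "p i \<le> x1"
proof -
  have p: "p 0 = x0" "p n = x1" "\<And>i. i < n \<Longrightarrow> p i < p (Suc i)"
    using assms(1) by (auto simp: interval_partition_def)
  have "j \<le> n \<Longrightarrow> p 0 \<le> p j" for j
  proof (induction j)
    case (Suc j)
    then show ?case using p(3)[of j] by simp
  qed simp
  then show "x0 \<le> p i" using assms(2) p(1) by simp
  have "p i \<le> p n" using assms(2)
  proof (induction rule: inc_induct)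
    case (step j)
    then show ?case using p(3)[of j] by simp
  qed simp
  then show "p i \<le> x1" using p(2) by simp
qed

lemma interval_partition_cover:
  assumes "interval_partition x0 x1 n p" "x \<in> {x0<..<x1}" "x \<notin> p ` {..n}"
  obtains i where "i < n" "x \<in> {p i<..<p (Suc i)}"
proof -
  have p: "p 0 = x0" "p n = x1" using assms(1) by (auto simp: interval_partition_def)
  have "j \<le> n \<Longrightarrow> x < p j \<Longrightarrow> \<exists>i<n. p i < x \<and> x < p (Suc i)" for j
  proof (induction j)
    case 0
    then show ?case using p assms(2) by simp
  next
    case (Suc j)
    have "x \<noteq> p j" using assms(3) Suc.prems by auto
    then consider "x < p j" | "p j < x" by linarith
    then show ?case
    proof cases
      case 1
      then show ?thesis using Suc by simp
    next
      case 2
      then show ?thesis using Suc.prems by (intro exI[of _ j]) auto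
    qed
  qed
  from this[of n] show thesis using p assms(2) that by auto
qed

lemma impedance_class_imp_impedance:
  assumes x01: "x0 < x1" and \<zeta>: "\<zeta> \<in> impedance_class x0 x1"
  obtains r S m K \<kappa> C where "impedance x0 x1 r S m K \<kappa> C \<zeta>"
proof -
  obtain \<epsilon> where \<epsilon>: "\<epsilon> > 0" "\<And>x. x \<in> {x0<..<x1} \<Longrightarrow> \<zeta> x > \<epsilon>"
    using \<zeta> unfolding impedance_class_def Cpw_pos_def Reg_pos_def by blast
  obtain n p where part: "interval_partition x0 x1 n p"
    and ac: "\<And>i. i < n \<Longrightarrow> abs_continuous_on {p i<..<p (Suc i)} \<zeta>"
    using \<zeta> unfolding impedance_class_def Cpw_pos_def by blast
  have lim0: "(\<zeta> \<longlongrightarrow> 1) (at_right x0)" using \<zeta> by (simp add: impedance_class_def)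
  have p: "p 0 = x0" "p n = x1" "\<And>i. i < n \<Longrightarrow> p i < p (Suc i)"
    using part by (auto simp: interval_partition_def)
  have n: "n > 0" using p x01 by (cases n) auto
  have piece: "{p i<..<p (Suc i)} \<subseteq> {x0<..<x1}" if "i < n" for i
    using interval_partition_bounds[OF part, of i] interval_partition_bounds[OF part, of "Suc i"] that
    by auto
  \<comment> \<open>The filler 1 at the partition points and outside the interval makes
    \<open>r\<close> bounded on the whole line and locally constant outside \<open>{x0..x1}\<close>.
    The 1 in \<open>m\<close> and the 1 in \<open>K\<close> account for it.\<close>
  define r where "r x = (if \<exists>i<n. x \<in> {p i<..<p (Suc i)} then \<zeta> x else 1)" for x
  define S where "S = p ` {..n}"
  have finS: "finite S" by (simp add: S_def)
  have r_piece: "r x = \<zeta> x" if "i < n" "x \<in> {p i<..<p (Suc i)}" for i x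
    using that by (auto simp: r_def)
  have uc: "uniformly_continuous_on {p i<..<p (Suc i)} \<zeta>" if "i < n" for i
    by (rule abs_continuous_imp_uniformly_continuous[OF ac[OF that] is_interval_oo])
  define m where "m = min \<epsilon> 1"
  have m: "m > 0" "m \<le> r x" for x
  proof -
    show "m > 0" using \<epsilon>(1) by (simp add: m_def)
    show "m \<le> r x"
    proof (cases "\<exists>i<n. x \<in> {p i<..<p (Suc i)}")
      case True
      then have "x \<in> {x0<..<x1}" using piece by blast
      then show ?thesis using \<epsilon>(2) True by (force simp: r_def m_def min_le_iff_disj)
    next
      case False
      then have "r x = 1" by (simp only: r_def if_False)
      then show ?thesis by (simp add: m_def)
    qed
  qed
  have "\<exists>B. \<forall>x\<in>{p i<..<p (Suc i)}. \<zeta> x \<le> B" if "i < n" for i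
  proof -
    have "bounded (\<zeta> ` {p i<..<p (Suc i)})"
      by (rule bounded_uniformly_continuous_image[OF uc[OF that]]) simp
    then obtain B where "\<forall>x\<in>{p i<..<p (Suc i)}. norm (\<zeta> x) \<le> B" unfolding bounded_iff by blast
    then show ?thesis by (intro exI[of _ B]) force
  qed
  then obtain B where B: "\<And>i x. i < n \<Longrightarrow> x \<in> {p i<..<p (Suc i)} \<Longrightarrow> \<zeta> x \<le> B i" by metis
  define K where "K = 1 + (\<Sum>i<n. \<bar>B i\<bar>)"
  have K: "r x \<le> K" for x
  proof (cases "\<exists>i<n. x \<in> {p i<..<p (Suc i)}")
    case True
    then obtain i where i: "i < n" "x \<in> {p i<..<p (Suc i)}" by blast
    have "r x \<le> \<bar>B i\<bar>" using B[OF i] r_piece[OF i] by linarith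
    also have "\<dots> \<le> (\<Sum>i<n. \<bar>B i\<bar>)" using i by (intro member_le_sum) auto
    finally show ?thesis by (simp add: K_def)
  next
    case False
    have "0 \<le> (\<Sum>i<n. \<bar>B i\<bar>)" by (intro sum_nonneg) auto
    moreover have "r x = 1" using False by (simp only: r_def if_False)
    ultimately show ?thesis by (simp add: K_def)
  qed
  have cont: "isCont r x" if not_S: "x \<notin> S" for x
  proof (cases "x \<in> {x0<..<x1}")
    case True
    then obtain i where i: "i < n" "x \<in> {p i<..<p (Suc i)}"
      using interval_partition_cover[OF part True] not_S unfolding S_def by blast
    have "continuous_on {p i<..<p (Suc i)} r"
      using uniformly_continuous_imp_continuous[OF uc[OF i(1)]]
      by (rule continuous_on_eq) (simp add: r_piece[OF i(1)])
    then show ?thesis using i(2) by (simp add: continuous_on_eq_continuous_at)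
  next
    case False
    have "x0 \<in> S" "x1 \<in> S" using p n unfolding S_def by (auto simp: image_iff intro: bexI[of _ 0] bexI[of _ n])
    then have x: "x \<in> - {x0..x1}" using False not_S by (cases "x = x0"; cases "x = x1") auto
    have "continuous_on (- {x0..x1}) (\<lambda>x. 1 :: real)" by simp
    then have "continuous_on (- {x0..x1}) r"
    proof (rule continuous_on_eq)
      fix y assume "y \<in> - {x0..x1}"
      then have "\<not> (\<exists>i<n. y \<in> {p i<..<p (Suc i)})" using piece by fastforce
      then show "1 = r y" by (simp only: r_def if_False)
    qed
    then show ?thesis using x by (simp add: continuous_on_eq_continuous_at open_Compl)
  qed
  have ac_r: "abs_continuous_on {p i<..<p (Suc i)} r" if "i < n" for i
  proof -
    have "abs_continuous_on {p i<..<p (Suc i)} (\<lambda>x. \<zeta> x - (\<zeta> x - r x))"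
      by (rule abs_continuous_on_diff_lipschitz[OF ac[OF that], of _ 0]) (simp add: r_piece[OF that])
    then show ?thesis by simp
  qed
  obtain C where C: "energy_estimate S r {x0..x1} C"
    using energy_estimate_partition[OF part x01 finS ac_r m K] by blast
  obtain k where k: "n = Suc k" using n by (cases n) auto
  have kn: "k < n" "p k < x1" "{p k<..<x1} \<subseteq> {x0<..<x1}" using k p(2) p(3)[of k] piece[of k] by auto
  \<comment> \<open>Uniform continuity on the last piece extends \<open>\<zeta>\<close> to
    \<open>x1\<close>. This yields the limit \<open>\<kappa>\<close>, which is positive because
    \<open>\<zeta>\<close> stays above \<open>\<epsilon>\<close>.\<close>
  obtain f where f: "uniformly_continuous_on (closure {p k<..<p (Suc k)}) f"
    "\<And>x. x \<in> {p k<..<p (Suc k)} \<Longrightarrow> \<zeta> x = f x"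
    using uniformly_continuous_on_extension_on_closure[OF uc[OF kn(1)]] by metis
  have pk: "p (Suc k) = x1" using p(2) k by simp
  have "continuous_on {p k..x1} f"
    using uniformly_continuous_imp_continuous[OF f(1)] kn(2) unfolding pk by simp
  then have "(f \<longlongrightarrow> f x1) (at_left x1)" using kn(2) by (rule continuous_on_Icc_at_leftD)
  moreover have ev: "eventually (\<lambda>x. x \<in> {p k<..<x1}) (at_left x1)"
    using eventually_at_left[OF kn(2)] kn(2) by auto
  ultimately have lim1: "(\<zeta> \<longlongrightarrow> f x1) (at_left x1)"
    by (rule Lim_transform_eventually[OF _ eventually_mono]) (use f(2) pk in auto)
  have "eventually (\<lambda>x. \<epsilon> \<le> \<zeta> x) (at_left x1)"
    using ev by (rule eventually_mono) (use \<epsilon>(2) kn(3) in \<open>meson less_imp_le subsetD\<close>)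
  then have "\<epsilon> \<le> f x1" by (rule tendsto_lowerbound[OF lim1]) simp
  then have \<kappa>: "f x1 > 0" using \<epsilon>(1) by simp
  have "impedance x0 x1 r S m K (f x1) C \<zeta>"
  proof unfold_locales
    show "r x = \<zeta> x" if "x \<in> {x0<..<x1} - S" for x
      using interval_partition_cover[OF part, of x] that r_piece unfolding S_def by blast
    show "\<zeta> x > 0" if "x \<in> {x0<..<x1}" for x using \<epsilon>(1) \<epsilon>(2)[OF that] by linarith
  qed (fact x01 finS m K cont \<kappa> C lim0 lim1)+
  then show thesis by (rule that)
qed

text \<open>Almost everywhere equal impedances may come with different partitions. With the
  exceptional set enlarged to \<open>S \<union> S'\<close>, solutions for one medium solve the
  system of the other, so the columns, having equal initial values, coincide at
  \<open>x1\<close>.\<close>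

lemma refl_cong:
  assumes "impedance x0 x1 r S m K \<kappa> C \<zeta>" "impedance x0 x1 r' S' m' K' \<kappa>' C' \<eta>"
    and eq: "\<And>x. x \<in> {x0<..<x1} - (S \<union> S') \<Longrightarrow> r x = r' x" and \<kappa>: "\<kappa> = \<kappa>'"
  shows "reflection r x0 x1 \<kappa> s = reflection r' x0 x1 \<kappa>' s"
proof -
  interpret M: impedance x0 x1 r S m K \<kappa> C \<zeta> by fact
  interpret N: impedance x0 x1 r' S' m' K' \<kappa>' C' \<eta> by fact
  have fin: "finite (S \<union> S')" using M.finS N.finS by simp
  have tr: "system_on {x0..x1} (S \<union> S') r' s u z" if "system_on {x0..x1} S r s u z" for u z
    unfolding system_on_def
  proof (intro conjI ballI)
    fix x assume x: "x \<in> interior {x0..x1} - (S \<union> S')"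
    then have rx: "r x = r' x" by (intro eq) simp
    from that x show "(u has_vector_derivative s * z x / of_real (r' x)) (at x)"
      "(z has_vector_derivative s * of_real (r' x) * u x) (at x)"
      unfolding system_on_def rx[symmetric] by auto
  qed (use that in \<open>auto simp: system_on_def\<close>)
  have tr': "system_on {x0..x1} (S \<union> S') r' s u z" if "system_on {x0..x1} S' r' s u z" for u z
    using that unfolding system_on_def by auto
  have x: "x0 \<in> {x0..x1}" "x1 \<in> {x0..x1}" using M.cd by auto
  have rep: "u x1 = u x0 * ch_u r' x0 s x1 + z x0 * sh_u r' x0 s x1 \<and>
      z x1 = u x0 * sh_z r' x0 s x1 + z x0 * ch_z r' x0 s x1"
    if sol: "system_on {x0..x1} S r s u z" for u z
  proof -
    obtain k l where "\<And>x. x \<in> {x0..x1} \<Longrightarrow> u x = k * ch_u r' x0 s x + l * sh_u r' x0 s x"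
      "\<And>x. x \<in> {x0..x1} \<Longrightarrow> z x = k * sh_z r' x0 s x + l * ch_z r' x0 s x"
      using system_on_represent[OF fin is_interval_cc tr[OF sol] tr'[OF N.system_on_columns(1)]
        tr'[OF N.system_on_columns(2)] N.columns_det] by metis
    with x show ?thesis by (simp add: N.columns_start)
  qed
  have "ch_u r x0 s x1 = ch_u r' x0 s x1" "sh_z r x0 s x1 = sh_z r' x0 s x1"
    "sh_u r x0 s x1 = sh_u r' x0 s x1" "ch_z r x0 s x1 = ch_z r' x0 s x1"
    using rep[OF M.system_on_columns(1)] rep[OF M.system_on_columns(2)]
    by (simp_all add: M.columns_start)
  then show ?thesis by (simp add: reflection_def amp_right_def amp_left_def \<kappa>)
qed

text \<open>The equivalence expresses a map on classes modulo equality almost everywhere: one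
  direction is injectivity, the other says that the map is well defined.\<close>

theorem theorem10:
  fixes x0 x1 :: real
  assumes "x0 < x1"
  shows "refl_coeff x0 x1 \<in> impedance_class x0 x1 \<rightarrow> bounded_smooth \<and>
    (\<forall>\<zeta>\<in>impedance_class x0 x1. \<forall>\<eta>\<in>impedance_class x0 x1.
       refl_coeff x0 x1 \<zeta> = refl_coeff x0 x1 \<eta> \<longleftrightarrow> ae_equal_on {x0<..<x1} \<zeta> \<eta>)"
proof (intro conjI Pi_I ballI)
  fix \<zeta> assume "\<zeta> \<in> impedance_class x0 x1"
  then obtain r S m K \<kappa> C where "impedance x0 x1 r S m K \<kappa> C \<zeta>"
    using impedance_class_imp_impedance[OF assms] by blast
  then interpret impedance x0 x1 r S m K \<kappa> C \<zeta> .
  show "refl_coeff x0 x1 \<zeta> \<in> bounded_smooth"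
    unfolding refl_coeff_eq by (rule refl_bounded_smooth)
next
  fix \<zeta> \<eta> assume cls: "\<zeta> \<in> impedance_class x0 x1" "\<eta> \<in> impedance_class x0 x1"
  obtain r S m K \<kappa> C where M: "impedance x0 x1 r S m K \<kappa> C \<zeta>"
    using impedance_class_imp_impedance[OF assms cls(1)] by blast
  obtain r' S' m' K' \<kappa>' C' where N: "impedance x0 x1 r' S' m' K' \<kappa>' C' \<eta>"
    using impedance_class_imp_impedance[OF assms cls(2)] by blast
  interpret M: impedance x0 x1 r S m K \<kappa> C \<zeta> by fact
  interpret N: impedance x0 x1 r' S' m' K' \<kappa>' C' \<eta> by fact
  have fin: "finite (S \<union> S')" using M.finS N.finS by simp
  show "refl_coeff x0 x1 \<zeta> = refl_coeff x0 x1 \<eta> \<longleftrightarrow> ae_equal_on {x0<..<x1} \<zeta> \<eta>"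
  proof
    assume "refl_coeff x0 x1 \<zeta> = refl_coeff x0 x1 \<eta>"
    then have "reflection r x0 x1 \<kappa> (\<i> * of_real \<omega>) = reflection r' x0 x1 \<kappa>' (\<i> * of_real \<omega>)" for \<omega>
      unfolding M.refl_coeff_eq N.refl_coeff_eq by (rule fun_cong)
    then interpret two_media x0 x1 r S m K \<kappa> C r' S' m' K' \<kappa>' C'
      by unfold_locales
    have "\<zeta> x = \<eta> x" if "x \<in> {x0<..<x1}" "x \<notin> S \<union> S'" for x
      using medium_eq[of x] M.r_eq[of x] N.r_eq[of x] that by simp
    note eq = this
    show "ae_equal_on {x0<..<x1} \<zeta> \<eta>"
      unfolding ae_equal_on_def using M.ae_not_S N.ae_not_S by eventually_elim (use eq in blast)
  next
    assume ae: "ae_equal_on {x0<..<x1} \<zeta> \<eta>"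
    have op: "open ({x0<..<x1} - (S \<union> S'))"
      by (intro open_Diff finite_imp_closed fin) auto
    have eq: "\<zeta> x = \<eta> x" if "x \<in> {x0<..<x1} - (S \<union> S')" for x
      by (rule ae_equal_continuous_imp_equal[OF ae op _ _ _ that])
         (auto intro: continuous_on_subset[OF M.\<zeta>_continuous] continuous_on_subset[OF N.\<zeta>_continuous])
    \<comment> \<open>The two impedances are known to agree only off \<open>S \<union> S'\<close>,
      which may contain \<open>x1\<close>. A punctured neighbourhood avoids this finite set, and so
      the left limits \<open>\<kappa>\<close> and \<open>\<kappa>'\<close> coincide.\<close>
    have "eventually (\<lambda>x. x \<notin> S \<union> S') (at x1)"
      using islimpt_finite[OF fin, of x1] by (simp add: islimpt_iff_eventually)
    then have "eventually (\<lambda>x. x \<notin> S \<union> S') (at_left x1)"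
      by (rule filter_leD[OF at_le[OF subset_UNIV]])
    then have "eventually (\<lambda>x. \<zeta> x = \<eta> x) (at_left x1)"
      using M.ev_right by eventually_elim (use eq in auto)
    from Lim_transform_eventually[OF M.\<zeta>_right this] have "\<kappa> = \<kappa>'"
      using N.\<zeta>_right by (rule tendsto_unique[OF trivial_limit_at_left_real])
    then have "reflection r x0 x1 \<kappa> s = reflection r' x0 x1 \<kappa>' s" for s
      using eq M.r_eq N.r_eq by (intro refl_cong[OF M N]) auto
    then show "refl_coeff x0 x1 \<zeta> = refl_coeff x0 x1 \<eta>"
      unfolding M.refl_coeff_eq N.refl_coeff_eq by simp
  qed
qed

end
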